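(* Let $n,k,s$ be integers with $0\le k\le n$ and $s\ge 1$, and let $\mathbf{d}=(d_1,\dots,d_s)$ be integers with all $d_i\ge 2$ and $\mathbf{d}\ne(2)$. Let $[\Lambda']\in \operatorname{Gr}(k,n)$ be generic, and let $[\mathbf{f}]\in\mathbb{P}\,\Gamma_{n+1}(\mathbf{d})$ be generic such that $\Lambda'\subseteq V(\mathbf{f})$. If $\delta(n,\mathbf{d},k)<0$, then $F_k(V(\mathbf{f}))=[\Lambda']$.
   Context: Work over $\mathbb{C}$. $\operatorname{Gr}(k,n)$ is the Grassmannian of $k$-dimensional projective linear subspaces ($k$-planes) $\Lambda\subseteq\mathbb{P}^n$; $[\Lambda]$ is the point corresponding to $\Lambda$. $\Gamma_{n+1}(d)$ is the vector space of homogeneous polynomials of degree $d$ in $n+1$ variables, and $\Gamma_{n+1}(\mathbf{d})=\prod_{i=1}^s\Gamma_{n+1}(d_i)$. For $\mathbf{f}=(f^{(1)},\dots,f^{(s)})\in\Gamma_{n+1}(\mathbf{d})$, $V(\mathbf{f})\subseteq\mathbb{P}^n$ is the common zero locus, and $F_k(V(\mathbf{f}))\subseteq\operatorname{Gr}(k,n)$ is the Fano scheme parametrizing $k$-planes contained in $V(\mathbf{f})$. "Scheme" may be read as "variety", so $F_k(V(\mathbf{f}))=[\Lambda']$ means that $\Lambda'$ is the only $k$-plane contained in $V(\mathbf{f})$. Set $\binom{\mathbf{d}+k}{k}=\sum_{i=1}^s\binom{d_i+k}{k}$ and $\delta(n,\mathbf{d},k)=(k+1)(n-k)-\binom{\mathbf{d}+k}{k}$.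 Genericity: for $\Lambda'$ in some dense Zariski-open subset of $\operatorname{Gr}(k,n)$, the conclusion holds for all $[\mathbf{f}]$ in some dense Zariski-open subset of the projective space $\mathbb{P}\,S_{\Lambda'}(\mathbf{d})$, where $S_{\Lambda'}(\mathbf{d})\subseteq\Gamma_{n+1}(\mathbf{d})$ is the linear subspace of tuples $\mathbf{f}$ with $\Lambda'\subseteq V(\mathbf{f})$. *)

theory Defs
  imports
    "HOL-Analysis.Abstract_Topology"
    "HOL-Library.Function_Algebras"
    "HOL-Library.Poly_Mapping"
    "Jordan_Normal_Form.Determinant"
begin

section \<open>Complex polynomials\<close>

type_synonym 'v monom = "'v \<Rightarrow>\<^sub>0 nat"
type_synonym 'v mpol = "'v monom \<Rightarrow>\<^sub>0 complex"

definition monom_eval :: "'v monom \<Rightarrow> ('v \<Rightarrow> complex) \<Rightarrow> complex" where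
  "monom_eval m x = (\<Prod>v\<in>Poly_Mapping.keys m. x v ^ Poly_Mapping.lookup m v)"

definition monom_deg :: "'v monom \<Rightarrow> nat" where
  "monom_deg m = (\<Sum>v\<in>Poly_Mapping.keys m. Poly_Mapping.lookup m v)"

definition mpol_eval :: "'v mpol \<Rightarrow> ('v \<Rightarrow> complex) \<Rightarrow> complex" where
  "mpol_eval p x = (\<Sum>m\<in>Poly_Mapping.keys p. Poly_Mapping.lookup p m * monom_eval m x)"

text \<open>The zero polynomial is homogeneous of every degree.\<close>

definition homogeneous :: "nat \<Rightarrow> 'v mpol \<Rightarrow> bool" where
  "homogeneous e p \<longleftrightarrow> (\<forall>m\<in>Poly_Mapping.keys p. monom_deg m = e)"

lemma monom_eval_superset:
  assumes "finite A" "Poly_Mapping.keys m \<subseteq> A"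
  shows "monom_eval m x = (\<Prod>v\<in>A. x v ^ Poly_Mapping.lookup m v)"
  unfolding monom_eval_def
  by (rule prod.mono_neutral_left) (use assms in \<open>auto simp: in_keys_iff\<close>)

lemma monom_deg_superset:
  assumes "finite A" "Poly_Mapping.keys m \<subseteq> A"
  shows "monom_deg m = (\<Sum>v\<in>A. Poly_Mapping.lookup m v)"
  unfolding monom_deg_def
  by (rule sum.mono_neutral_left) (use assms in \<open>auto simp: in_keys_iff\<close>)

lemma mpol_eval_superset:
  assumes "finite A" "Poly_Mapping.keys p \<subseteq> A"
  shows "mpol_eval p x = (\<Sum>m\<in>A. Poly_Mapping.lookup p m * monom_eval m x)"
  unfolding mpol_eval_def
  by (rule sum.mono_neutral_left) (use assms in \<open>auto simp: in_keys_iff\<close>)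

lemma monom_eval_add: "monom_eval (m + m') x = monom_eval m x * monom_eval m' x"
proof -
  let ?A = "Poly_Mapping.keys m \<union> Poly_Mapping.keys m'"
  have "Poly_Mapping.keys (m + m') \<subseteq> ?A" by (rule keys_add)
  then show ?thesis
    by (simp add: monom_eval_superset[of ?A] lookup_add power_add prod.distrib)
qed

lemma monom_deg_add: "monom_deg (m + m') = monom_deg m + monom_deg m'"
proof -
  let ?A = "Poly_Mapping.keys m \<union> Poly_Mapping.keys m'"
  have "Poly_Mapping.keys (m + m') \<subseteq> ?A" by (rule keys_add)
  then show ?thesis
    by (simp add: monom_deg_superset[of ?A] lookup_add sum.distrib)
qed

lemma mpol_eval_zero [simp]: "mpol_eval 0 x = 0"
  by (simp add: mpol_eval_def)

lemma mpol_eval_single: "mpol_eval (Poly_Mapping.single m c) x = c * monom_eval m x"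
  by (cases "c = 0") (simp_all add: mpol_eval_def)

lemma mpol_eval_one [simp]: "mpol_eval 1 x = 1"
  using mpol_eval_single[of 0 1 x] by (simp add: monom_eval_def)

lemma mpol_eval_add: "mpol_eval (p + q) x = mpol_eval p x + mpol_eval q x"
proof -
  let ?A = "Poly_Mapping.keys p \<union> Poly_Mapping.keys q"
  have "Poly_Mapping.keys (p + q) \<subseteq> ?A" by (rule keys_add)
  then show ?thesis
    by (simp add: mpol_eval_superset[of ?A] lookup_add distrib_right sum.distrib)
qed

lemma mpol_eval_sum: "mpol_eval (\<Sum>i\<in>I. f i) x = (\<Sum>i\<in>I. mpol_eval (f i) x)"
  by (induction I rule: infinite_finite_induct) (simp_all add: mpol_eval_add)

lemma mpol_expand: "p = (\<Sum>m\<in>Poly_Mapping.keys p. Poly_Mapping.single m (Poly_Mapping.lookup p m))"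
  by (rule poly_mapping_eqI)
    (auto simp: lookup_sum lookup_single when_def sum.delta in_keys_iff)

lemma mpol_eval_mult: "mpol_eval (p * q) x = mpol_eval p x * mpol_eval q x"
proof -
  have "p * q = (\<Sum>m\<in>Poly_Mapping.keys p. Poly_Mapping.single m (Poly_Mapping.lookup p m))
              * (\<Sum>m\<in>Poly_Mapping.keys q. Poly_Mapping.single m (Poly_Mapping.lookup q m))"
    by (rule arg_cong2[of _ _ _ _ "(*)"], rule mpol_expand, rule mpol_expand)
  also have "\<dots> = (\<Sum>m\<in>Poly_Mapping.keys p. \<Sum>m'\<in>Poly_Mapping.keys q.
      Poly_Mapping.single (m + m') (Poly_Mapping.lookup p m * Poly_Mapping.lookup q m'))"
    by (simp add: sum_product mult_single)
  finally have "mpol_eval (p * q) x = (\<Sum>m\<in>Poly_Mapping.keys p. \<Sum>m'\<in>Poly_Mapping.keys q.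
      (Poly_Mapping.lookup p m * Poly_Mapping.lookup q m') * (monom_eval m x * monom_eval m' x))"
    by (simp add: mpol_eval_sum mpol_eval_single monom_eval_add)
  also have "\<dots> = mpol_eval p x * mpol_eval q x"
    by (simp add: mpol_eval_def sum_product mult_ac)
  finally show ?thesis .
qed

lemma homogeneous_one: "homogeneous 0 1"
  by (simp add: homogeneous_def monom_deg_def)

lemma homogeneous_mult:
  assumes "homogeneous a p" "homogeneous b q"
  shows "homogeneous (a + b) (p * q)"
  using assms keys_mult[of p q] by (fastforce simp: homogeneous_def monom_deg_add)


section \<open>Projective spaces\<close>

text \<open>The projective space of \<open>V\<close> is the quotient of \<open>V - {0}\<close> by nonzero scalars; a point is
  the set of all its representatives.\<close>

definition proj_class :: "(complex \<Rightarrow> 'a \<Rightarrow> 'a) \<Rightarrow> 'a \<Rightarrow> 'a set" where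
  "proj_class sc x = {sc c x | c. c \<noteq> 0}"

definition proj :: "(complex \<Rightarrow> 'a \<Rightarrow> 'a::zero) \<Rightarrow> 'a set \<Rightarrow> 'a set set" where
  "proj sc V = proj_class sc ` (V - {0})"

definition vscale :: "complex \<Rightarrow> ('v \<Rightarrow> complex) \<Rightarrow> 'v \<Rightarrow> complex" where
  "vscale c x = (\<lambda>v. c * x v)"

global_interpretation vs: vector_space "vscale :: complex \<Rightarrow> ('v \<Rightarrow> complex) \<Rightarrow> 'v \<Rightarrow> complex"
  by unfold_locales (auto simp: vscale_def algebra_simps)

text \<open>The affine space of dimension \<open>n + 1\<close>, with coordinates indexed by \<open>0, \<dots>, n\<close>.\<close>

definition Aff :: "nat \<Rightarrow> (nat \<Rightarrow> complex) set" where
  "Aff n = {x. \<forall>i>n. x i = 0}"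

definition PP :: "nat \<Rightarrow> (nat \<Rightarrow> complex) set set" where
  "PP n = proj vscale (Aff n)"

text \<open>A \<open>k\<close>-plane is a set of points of projective space.\<close>

definition Gr :: "nat \<Rightarrow> nat \<Rightarrow> (nat \<Rightarrow> complex) set set set" where
  "Gr k n = {proj vscale W | W. vs.subspace W \<and> W \<subseteq> Aff n \<and> vs.dim W = k + 1}"


section \<open>Zariski topologies\<close>

text \<open>Here \<open>R x\<close> is the set of all vectors of homogeneous coordinates of the point \<open>x\<close>; these
  differ by nonzero factors, so a homogeneous polynomial vanishes at all of them or at none.
  The open sets are the complements of the common zero loci of sets of homogeneous
  polynomials, that is, the unions of sets \<open>nonzero_locus X R p\<close>.\<close>

definition nonzero_locus :: "'a set \<Rightarrow> ('a \<Rightarrow> ('v \<Rightarrow> complex) set) \<Rightarrow> 'v mpol \<Rightarrow> 'a set" where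
  "nonzero_locus X R p = {x \<in> X. \<forall>c\<in>R x. mpol_eval p c \<noteq> 0}"

definition zariski :: "'a set \<Rightarrow> ('a \<Rightarrow> ('v \<Rightarrow> complex) set) \<Rightarrow> 'a topology" where
  "zariski X R = topology (\<lambda>U. \<exists>P. (\<forall>p\<in>P. \<exists>e. homogeneous e p) \<and> U = (\<Union>p\<in>P. nonzero_locus X R p))"

lemma nonzero_locus_mult:
  "nonzero_locus X R (p * q) = nonzero_locus X R p \<inter> nonzero_locus X R q"
  by (auto simp: nonzero_locus_def mpol_eval_mult)

lemma istopology_zariski:
  "istopology (\<lambda>U. \<exists>P. (\<forall>p\<in>P. \<exists>e. homogeneous e p) \<and> U = (\<Union>p\<in>P. nonzero_locus X R p))"
    (is "istopology ?O")
  unfolding istopology_def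
proof (intro conjI allI impI)
  fix S T assume "?O S" "?O T"
  then obtain P Q where P: "\<forall>p\<in>P. \<exists>e. homogeneous e p" "S = (\<Union>p\<in>P. nonzero_locus X R p)"
    and Q: "\<forall>p\<in>Q. \<exists>e. homogeneous e p" "T = (\<Union>p\<in>Q. nonzero_locus X R p)"
    by blast
  let ?PQ = "(\<lambda>(p, q). p * q) ` (P \<times> Q)"
  have "\<forall>p\<in>?PQ. \<exists>e. homogeneous e p"
    using P(1) Q(1) homogeneous_mult by fastforce
  moreover have "S \<inter> T = (\<Union>p\<in>?PQ. nonzero_locus X R p)"
    unfolding P(2) Q(2) by (auto simp: nonzero_locus_mult)
  ultimately show "?O (S \<inter> T)" by blast
next
  fix K assume K: "\<forall>S\<in>K. ?O S"
  let ?P = "{p. (\<exists>e. homogeneous e p) \<and> nonzero_locus X R p \<subseteq> \<Union>K}"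
  have "x \<in> (\<Union>p\<in>?P. nonzero_locus X R p)" if S: "S \<in> K" "x \<in> S" for S x
  proof -
    obtain P where P: "\<forall>p\<in>P. \<exists>e. homogeneous e p" "S = (\<Union>p\<in>P. nonzero_locus X R p)"
      using K S(1) by blast
    then obtain p where p: "p \<in> P" "x \<in> nonzero_locus X R p"
      using S(2) by blast
    then have "nonzero_locus X R p \<subseteq> S" unfolding P(2) by (intro UN_upper)
    also have "S \<subseteq> \<Union>K" using S(1) by (rule Union_upper)
    finally have "p \<in> ?P" using P(1) p(1) by simp
    then show ?thesis using p(2) by (rule UN_I)
  qed
  moreover have "(\<Union>p\<in>?P. nonzero_locus X R p) \<subseteq> \<Union>K" by (rule UN_least) simp
  ultimately have "\<Union>K = (\<Union>p\<in>?P. nonzero_locus X R p)" by (intro subset_antisym subsetI) auto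
  moreover have "\<forall>p\<in>?P. \<exists>e. homogeneous e p" by simp
  ultimately show "?O (\<Union>K)" by (intro exI[of _ ?P] conjI)
qed

lemma openin_zariski:
  "openin (zariski X R) U \<longleftrightarrow>
    (\<exists>P. (\<forall>p\<in>P. \<exists>e. homogeneous e p) \<and> U = (\<Union>p\<in>P. nonzero_locus X R p))"
  unfolding zariski_def by (simp add: topology_inverse'[OF istopology_zariski])

lemma topspace_zariski: "topspace (zariski X R) = X"
proof
  show "topspace (zariski X R) \<subseteq> X"
    unfolding topspace_def openin_zariski by (auto simp: nonzero_locus_def)
  have "openin (zariski X R) X"
    unfolding openin_zariski
    by (rule exI[of _ "{1}"]) (auto simp: nonzero_locus_def intro: homogeneous_one)
  then show "X \<subseteq> topspace (zariski X R)" by (rule openin_subset)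
qed

definition dense_open :: "'a topology \<Rightarrow> 'a set \<Rightarrow> bool" where
  "dense_open T U \<longleftrightarrow> openin T U \<and> T closure_of U = topspace T"

text \<open>The Pluecker coordinates of the span of the vectors \<open>b 0, \<dots>, b k\<close> are the maximal minors
  of the matrix with these rows. They are indexed by the sets of \<open>k + 1\<close> columns; coordinates
  at all other indices are zero.\<close>

definition pluecker :: "nat \<Rightarrow> (nat \<Rightarrow> nat \<Rightarrow> complex) \<Rightarrow> nat set \<Rightarrow> complex" where
  "pluecker k b I = (if card I = k + 1
     then det (mat (k + 1) (k + 1) (\<lambda>(a, j). b a (sorted_list_of_set I ! j))) else 0)"

definition pluecker_coords :: "nat \<Rightarrow> (nat \<Rightarrow> complex) set set \<Rightarrow> (nat set \<Rightarrow> complex) set" where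
  "pluecker_coords k \<Lambda> = {pluecker k b | b. proj vscale (vs.span (b ` {..k})) = \<Lambda>}"

definition Gr_topology :: "nat \<Rightarrow> nat \<Rightarrow> (nat \<Rightarrow> complex) set set topology" where
  "Gr_topology k n = zariski (Gr k n) (pluecker_coords k)"


section \<open>Tuples of homogeneous polynomials and Fano schemes\<close>

definition Hom :: "nat \<Rightarrow> nat \<Rightarrow> nat mpol set" where
  "Hom n e = {p. homogeneous e p \<and> (\<forall>m\<in>Poly_Mapping.keys p. Poly_Mapping.keys m \<subseteq> {..n})}"

text \<open>An \<open>s\<close>-tuple is indexed by \<open>0, \<dots>, s - 1\<close> and is zero at all other indices.\<close>

definition HomTuples :: "nat \<Rightarrow> nat \<Rightarrow> (nat \<Rightarrow> nat) \<Rightarrow> (nat \<Rightarrow> nat mpol) set" where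
  "HomTuples n s d = {f. (\<forall>i<s. f i \<in> Hom n (d i)) \<and> (\<forall>i\<ge>s. f i = 0)}"

definition tscale :: "complex \<Rightarrow> (nat \<Rightarrow> nat mpol) \<Rightarrow> nat \<Rightarrow> nat mpol" where
  "tscale c f = (\<lambda>i. Poly_Mapping.map ((*) c) (f i))"

definition zero_variety :: "nat \<Rightarrow> nat \<Rightarrow> (nat \<Rightarrow> nat mpol) \<Rightarrow> (nat \<Rightarrow> complex) set set" where
  "zero_variety n s f = {L \<in> PP n. \<forall>i<s. \<forall>x\<in>L. mpol_eval (f i) x = 0}"

definition Fano :: "nat \<Rightarrow> nat \<Rightarrow> (nat \<Rightarrow> complex) set set \<Rightarrow> (nat \<Rightarrow> complex) set set set" where
  "Fano k n X = {\<Lambda> \<in> Gr k n. \<Lambda> \<subseteq> X}"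

definition tuples_through :: "nat \<Rightarrow> nat \<Rightarrow> (nat \<Rightarrow> nat) \<Rightarrow> (nat \<Rightarrow> complex) set set \<Rightarrow> (nat \<Rightarrow> nat mpol) set" where
  "tuples_through n s d \<Lambda> = {f \<in> HomTuples n s d. \<Lambda> \<subseteq> zero_variety n s f}"

definition coeffs_of :: "(nat \<Rightarrow> nat mpol) \<Rightarrow> nat \<times> nat monom \<Rightarrow> complex" where
  "coeffs_of f = (\<lambda>(i, m). Poly_Mapping.lookup (f i) m)"

text \<open>The coefficients are homogeneous coordinates on the projective space of \<open>HomTuples n s d\<close>, so
  this is the topology induced from there on the linear subspace given by \<open>tuples_through n s d \<Lambda>\<close>.\<close>

definition PS_topology ::
  "nat \<Rightarrow> nat \<Rightarrow> (nat \<Rightarrow> nat) \<Rightarrow> (nat \<Rightarrow> complex) set set \<Rightarrow> (nat \<Rightarrow> nat mpol) set topology" where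
  "PS_topology n s d \<Lambda> = zariski (proj tscale (tuples_through n s d \<Lambda>)) ((`) coeffs_of)"

definition delta :: "nat \<Rightarrow> nat \<Rightarrow> (nat \<Rightarrow> nat) \<Rightarrow> nat \<Rightarrow> int" where
  "delta n s d k = (int k + 1) * (int n - int k) - (\<Sum>i<s. int ((d i + k) choose k))"

end

theory Submission
  imports Defs
begin

text \<open>
  The theorem is a dimension count. Fix \<open>\<Lambda>' = P(W')\<close>, and let \<open>S\<close> be the linear space of the tuples
  that vanish on \<open>W'\<close>. Call a tuple in \<open>S\<close> bad if it also vanishes on some other \<open>W\<close> of dimension
  \<open>k + 1\<close>. Write \<open>N(a, e) = (a + e - 1) choose e\<close> for the number of monomials of degree \<open>e\<close> in \<open>a\<close>
  variables. The spaces \<open>W\<close> with \<open>dim (W \<inter> W') = a\<close> depend on \<open>(k + 1 - a) * (a + n - k)\<close> parameters,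
  and vanishing on one of them imposes \<open>\<Sum>i. N(k + 1, d i) - N(a, d i)\<close> independent conditions on \<open>S\<close>. Let
  \<open>\<phi>(a)\<close> be the number of parameters minus the number of conditions. Then \<open>\<phi>(0) = \<delta> < 0\<close> and
  \<open>\<phi>(k + 1) = 0\<close>. The second difference of \<open>\<phi>\<close> is a sum of binomial coefficients minus \<open>2\<close>; each
  \<open>d i \<ge> 2\<close> contributes at least \<open>1\<close>, and at least \<open>2\<close> if \<open>d i \<ge> 3\<close>, so \<open>\<phi>\<close> is convex unless the
  tuple is a single quadric. A convex \<open>\<phi>\<close> is negative on all of \<open>0, \<dots>, k\<close> (\<open>dimension_inequality\<close>),
  so that for every position of \<open>W\<close> the bad tuples form a set of smaller dimension than \<open>S\<close>.

  To turn this count into an equation, the bad tuples are parametrised by polynomials. In a basis of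
  which the first \<open>k + 1\<close> vectors span \<open>W'\<close>, Gaussian elimination that respects \<open>W'\<close> puts \<open>W\<close> into
  one of finitely many charts (\<open>subspace_has_chart\<close>): a set \<open>C\<close> of \<open>k + 1\<close> pivots and a matrix \<open>N\<close>
  such that a shear with the entries of \<open>N\<close>, preserving \<open>W'\<close>, carries the coordinate subspace of
  \<open>C\<close> to \<open>W\<close>. Composed with the shear, a bad tuple becomes a combination of the monomials that are
  supported neither in \<open>C\<close> nor in \<open>{0, \<dots>, k}\<close>. Since the inverse of the shear is the shear with
  matrix \<open>- N\<close>, the values of a bad tuple at fixed points are polynomials in the entries of \<open>N\<close> and
  the coefficients of those monomials (\<open>evaluations_in_chart\<close>).

  Choose \<open>dim S\<close> points whose values are coordinates on \<open>S\<close> (\<open>evaluation_points\<close>). By the count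
  there are more values than parameters, so that the values of bad tuples satisfy a nontrivial
  polynomial relation (\<open>algebraic_dependence\<close>). The bad tuples of a chart form a cone, so a homogeneous
  component of the relation vanishes on them too; it does not vanish on all of \<open>S\<close>
  (\<open>chart_obstruction\<close>). The product of these polynomials over all charts is again nonzero on \<open>S\<close>,
  and its nonzero locus is the required dense open set of tuples. Nothing in the argument depends on the choice
  of \<open>\<Lambda>'\<close>, so the dense open set of planes is the whole Grassmannian.
\<close>

section \<open>Polynomials as functions\<close>

text \<open>A homogeneous linear system with more unknowns than equations has a nontrivial solution. The
  arguments below that compare numbers of monomials, parameters, pivots or points all reduce to this form, so that no
  dimension of a space of polynomials has to be computed. The induction eliminates one unknown with one equation.\<close>

lemma linear_system_nontrivial_solution:
  fixes a :: "'e \<Rightarrow> 'f \<Rightarrow> 'k::field"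
  assumes "finite F" "finite E" "card F < card E"
  shows "\<exists>c. (\<exists>m\<in>E. c m \<noteq> 0) \<and> (\<forall>f\<in>F. (\<Sum>m\<in>E. c m * a m f) = 0)"
  using assms
proof (induction F arbitrary: E a rule: finite_induct)
  case empty
  then obtain m where "m \<in> E" by (metis card.empty card_gt_0_iff ex_in_conv)
  then show ?case by (intro exI[of _ "\<lambda>_. 1"]) auto
next
  case (insert g F)
  show ?case
  proof (cases "\<forall>m\<in>E. a m g = 0")
    case True
    have "card F < card E" using insert.prems insert.hyps by simp
    from insert.IH[OF insert.prems(1) this, of a] obtain c
      where "\<exists>m\<in>E. c m \<noteq> 0" "\<forall>f\<in>F. (\<Sum>m\<in>E. c m * a m f) = 0" by blast
    then show ?thesis using True by (intro exI[of _ c]) auto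
  next
    case False
    then obtain m0 where m0: "m0 \<in> E" "a m0 g \<noteq> 0" by blast
    let ?E = "E - {m0}"
    define a' where "a' m f = a m f - a m g / a m0 g * a m0 f" for m f
    have "finite ?E" "card F < card ?E"
      using insert.prems insert.hyps m0 by auto
    from insert.IH[OF this, of a'] obtain c
      where c: "\<exists>m\<in>?E. c m \<noteq> 0" "\<forall>f\<in>F. (\<Sum>m\<in>?E. c m * a' m f) = 0" by blast
    define c0 where "c0 = - (\<Sum>m\<in>?E. c m * a m g) / a m0 g"
    define c' where "c' = c(m0 := c0)"
    have split: "(\<Sum>m\<in>E. c' m * a m f) = c0 * a m0 f + (\<Sum>m\<in>?E. c m * a m f)" for f
    proof -
      have "(\<Sum>m\<in>E. c' m * a m f) = c' m0 * a m0 f + (\<Sum>m\<in>?E. c' m * a m f)"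
        by (rule sum.remove[OF insert.prems(1) m0(1)])
      also have "(\<Sum>m\<in>?E. c' m * a m f) = (\<Sum>m\<in>?E. c m * a m f)"
        by (rule sum.cong) (auto simp: c'_def)
      finally show ?thesis by (simp add: c'_def)
    qed
    have g: "(\<Sum>m\<in>E. c' m * a m g) = 0"
      unfolding split c0_def using m0(2) by simp
    have F: "(\<Sum>m\<in>E. c' m * a m f) = 0" if "f \<in> F" for f
    proof -
      have "0 = (\<Sum>m\<in>?E. c m * a' m f)" using c(2) that by simp
      also have "\<dots> = (\<Sum>m\<in>?E. c m * a m f) - (\<Sum>m\<in>?E. c m * a m g) / a m0 g * a m0 f"
        by (simp add: a'_def sum_subtractf algebra_simps sum_distrib_left sum_divide_distrib)
      also have "\<dots> = (\<Sum>m\<in>E. c' m * a m f)"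
        unfolding split c0_def by simp
      finally show ?thesis by simp
    qed
    have "\<exists>m\<in>E. c' m \<noteq> 0" using c(1) by (auto simp: c'_def)
    then show ?thesis using g F by (intro exI[of _ c']) auto
  qed
qed

lemma monom_eval_mult: "monom_eval m (\<lambda>v. x v * y v) = monom_eval m x * monom_eval m y"
  by (simp add: monom_eval_def power_mult_distrib prod.distrib)

lemma monom_eval_two_at: "monom_eval m (\<lambda>w. if w = v then 2 else 1) = 2 ^ Poly_Mapping.lookup m v"
proof -
  have "monom_eval m (\<lambda>w. if w = v then 2 else 1) =
      (\<Prod>w\<in>insert v (Poly_Mapping.keys m). (if w = v then 2 else 1) ^ Poly_Mapping.lookup m w)"
    by (rule monom_eval_superset) auto
  also have "\<dots> = (\<Prod>w\<in>insert v (Poly_Mapping.keys m). if w = v then 2 ^ Poly_Mapping.lookup m v else 1)"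
    by (rule prod.cong) auto
  also have "\<dots> = 2 ^ Poly_Mapping.lookup m v" by (subst prod.delta) auto
  finally show ?thesis .
qed

text \<open>Monomials are pairwise distinct multiplicative characters, so this is Dedekind's independence of
  characters: comparing a relation at \<open>x\<close> with the same relation at the componentwise product of \<open>x\<close>
  and \<open>y\<close> removes one monomial from it.\<close>

lemma monomials_linearly_independent:
  assumes "finite E" "\<And>x. (\<Sum>m\<in>E. c m * monom_eval m x) = 0" "m \<in> E"
  shows "c m = (0::complex)"
  using assms
proof (induction E arbitrary: c m rule: finite_psubset_induct)
  case (psubset E)
  show ?case
  proof (cases "E = {m}")
    case True
    then show ?thesis using psubset.prems(1)[of "\<lambda>_. 1"] by (simp add: monom_eval_def)
  next
    case False
    then obtain m' where m': "m' \<in> E" "m' \<noteq> m" using psubset.prems by blast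
    then obtain v where v: "Poly_Mapping.lookup m' v \<noteq> Poly_Mapping.lookup m v"
      using poly_mapping_eqI by metis
    define y :: "'a \<Rightarrow> complex" where "y = (\<lambda>w. if w = v then 2 else 1)"
    have ne: "monom_eval m y \<noteq> monom_eval m' y"
    proof
      assume "monom_eval m y = monom_eval m' y"
      then have "of_nat (2 ^ Poly_Mapping.lookup m v) = (of_nat (2 ^ Poly_Mapping.lookup m' v) :: complex)"
        by (simp add: y_def monom_eval_two_at)
      then show False using v by (simp only: of_nat_eq_iff) simp
    qed
    define c' where "c' l = c l * (monom_eval l y - monom_eval m' y)" for l
    have "(\<Sum>l\<in>E - {m'}. c' l * monom_eval l x) = 0" for x
    proof -
      have "(\<Sum>l\<in>E - {m'}. c' l * monom_eval l x) = (\<Sum>l\<in>E. c' l * monom_eval l x)"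
        using psubset.hyps m' by (simp add: sum.remove[of E m'] c'_def)
      also have "\<dots> = (\<Sum>l\<in>E. c l * monom_eval l (\<lambda>v. x v * y v))
          - monom_eval m' y * (\<Sum>l\<in>E. c l * monom_eval l x)"
        by (simp add: monom_eval_mult c'_def sum_distrib_left sum_subtractf algebra_simps)
      also have "\<dots> = 0" using psubset.prems(1) by simp
      finally show ?thesis .
    qed
    then have "c' m = 0"
      using psubset.IH[of "E - {m'}" c' m] m' psubset.prems(2) by blast
    then show ?thesis using ne by (simp add: c'_def)
  qed
qed

lemma mpol_eq_zeroI:
  assumes "\<And>x. mpol_eval p x = 0"
  shows "p = 0"
proof (rule ccontr)
  assume "p \<noteq> 0"
  then obtain m where "m \<in> Poly_Mapping.keys p" by (metis in_keys_iff lookup_zero poly_mapping_eqI)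
  then show False
    using monomials_linearly_independent[of "Poly_Mapping.keys p" "Poly_Mapping.lookup p" m] assms
    by (simp add: mpol_eval_def in_keys_iff)
qed

lemma mpol_eval_power: "mpol_eval (p ^ n) x = mpol_eval p x ^ n"
  by (induction n) (simp_all add: mpol_eval_mult)

lemma mpol_eval_prod: "mpol_eval (\<Prod>i\<in>I. f i) x = (\<Prod>i\<in>I. mpol_eval (f i) x)"
  by (induction I rule: infinite_finite_induct) (simp_all add: mpol_eval_mult)

lemma homogeneous_sum:
  assumes "\<And>i. i \<in> I \<Longrightarrow> homogeneous e (f i)"
  shows "homogeneous e (\<Sum>i\<in>I. f i)"
  using assms
proof (induction I rule: infinite_finite_induct)
  case (insert i I)
  then show ?case using keys_add[of "f i" "\<Sum>i\<in>I. f i"] by (fastforce simp: homogeneous_def)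
qed (auto simp: homogeneous_def)

lemma homogeneous_prod:
  assumes "\<And>i. i \<in> I \<Longrightarrow> homogeneous (e i) (f i)"
  shows "homogeneous (\<Sum>i\<in>I. e i) (\<Prod>i\<in>I. f i)"
  using assms
  by (induction I rule: infinite_finite_induct) (auto intro: homogeneous_mult homogeneous_one)

lemma homogeneous_power: "homogeneous e p \<Longrightarrow> homogeneous (e * n) (p ^ n)"
  by (induction n) (auto intro: homogeneous_mult homogeneous_one)

lemma homogeneous_const: "homogeneous 0 (Poly_Mapping.single 0 c)"
  by (simp add: homogeneous_def monom_deg_def)

lemma mpol_eval_const: "mpol_eval (Poly_Mapping.single 0 c) x = c"
  by (simp add: mpol_eval_single monom_eval_def)

definition var :: "'v \<Rightarrow> 'v mpol" where
  "var v = Poly_Mapping.single (Poly_Mapping.single v 1) 1"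

lemma mpol_eval_var [simp]: "mpol_eval (var v) x = x v"
  by (simp add: var_def mpol_eval_single monom_eval_def)

lemma homogeneous_var: "homogeneous 1 (var v)"
  by (simp add: var_def homogeneous_def monom_deg_def)

text \<open>Constants are written \<open>single 0 c\<close>, since the zero exponent is the unit monomial.\<close>

definition msubst :: "('v \<Rightarrow> 'w mpol) \<Rightarrow> 'v mpol \<Rightarrow> 'w mpol" where
  "msubst \<sigma> p = (\<Sum>m\<in>Poly_Mapping.keys p. Poly_Mapping.single 0 (Poly_Mapping.lookup p m) *
     (\<Prod>v\<in>Poly_Mapping.keys m. \<sigma> v ^ Poly_Mapping.lookup m v))"

lemma mpol_eval_msubst: "mpol_eval (msubst \<sigma> p) x = mpol_eval p (\<lambda>v. mpol_eval (\<sigma> v) x)"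
  by (simp add: msubst_def mpol_eval_sum mpol_eval_mult mpol_eval_const mpol_eval_prod
      mpol_eval_power mpol_eval_def[of p] monom_eval_def[of _ "\<lambda>v. mpol_eval (\<sigma> v) x"])

lemma homogeneous_msubst:
  assumes "homogeneous e p" "\<And>v. homogeneous 1 (\<sigma> v)"
  shows "homogeneous e (msubst \<sigma> p)"
  unfolding msubst_def
proof (rule homogeneous_sum)
  fix m assume m: "m \<in> Poly_Mapping.keys p"
  have "homogeneous (0 + (\<Sum>v\<in>Poly_Mapping.keys m. 1 * Poly_Mapping.lookup m v))
      (Poly_Mapping.single 0 (Poly_Mapping.lookup p m) *
     (\<Prod>v\<in>Poly_Mapping.keys m. \<sigma> v ^ Poly_Mapping.lookup m v))"
    by (intro homogeneous_mult homogeneous_const homogeneous_prod homogeneous_power assms)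
  also have "0 + (\<Sum>v\<in>Poly_Mapping.keys m. 1 * Poly_Mapping.lookup m v) = e"
    using assms(1) m by (simp add: homogeneous_def monom_deg_def)
  finally show "homogeneous e (Poly_Mapping.single 0 (Poly_Mapping.lookup p m) *
     (\<Prod>v\<in>Poly_Mapping.keys m. \<sigma> v ^ Poly_Mapping.lookup m v))" .
qed

definition mpols_in :: "'v set \<Rightarrow> 'v mpol set" where
  "mpols_in X = {p. \<forall>m\<in>Poly_Mapping.keys p. Poly_Mapping.keys m \<subseteq> X}"

lemma mpols_in_mult: "p \<in> mpols_in X \<Longrightarrow> q \<in> mpols_in X \<Longrightarrow> p * q \<in> mpols_in X"
  using keys_mult[of p q] keys_add unfolding mpols_in_def by (fastforce dest!: subsetD)

lemma mpols_in_add: "p \<in> mpols_in X \<Longrightarrow> q \<in> mpols_in X \<Longrightarrow> p + q \<in> mpols_in X"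
  using keys_add[of p q] unfolding mpols_in_def by blast

lemma mpols_in_const: "Poly_Mapping.single 0 c \<in> mpols_in X"
  by (simp add: mpols_in_def)

lemma mpols_in_var: "v \<in> X \<Longrightarrow> var v \<in> mpols_in X"
  by (simp add: mpols_in_def var_def)

lemma mpols_in_zero: "0 \<in> mpols_in X"
  by (simp add: mpols_in_def)

lemma mpols_in_sum: "(\<And>i. i \<in> I \<Longrightarrow> f i \<in> mpols_in X) \<Longrightarrow> (\<Sum>i\<in>I. f i) \<in> mpols_in X"
  by (induction I rule: infinite_finite_induct) (auto intro: mpols_in_add mpols_in_zero)

lemma mpols_in_one: "1 \<in> mpols_in X"
  using mpols_in_const[of 1 X] by simp

lemma mpols_in_prod: "(\<And>i. i \<in> I \<Longrightarrow> f i \<in> mpols_in X) \<Longrightarrow> (\<Prod>i\<in>I. f i) \<in> mpols_in X"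
  by (induction I rule: infinite_finite_induct) (auto intro: mpols_in_mult mpols_in_one)

lemma mpols_in_power: "p \<in> mpols_in X \<Longrightarrow> p ^ n \<in> mpols_in X"
  by (induction n) (auto intro: mpols_in_mult mpols_in_one)

lemma mpols_in_msubst:
  assumes "p \<in> mpols_in Y" "\<And>v. v \<in> Y \<Longrightarrow> \<sigma> v \<in> mpols_in X"
  shows "msubst \<sigma> p \<in> mpols_in X"
  unfolding msubst_def
  by (intro mpols_in_sum mpols_in_mult mpols_in_const mpols_in_prod mpols_in_power assms(2))
    (use assms(1) in \<open>auto simp: mpols_in_def\<close>)

section \<open>Algebraic dependence\<close>

definition box :: "'v set \<Rightarrow> nat \<Rightarrow> 'v monom set" where
  "box X e = {m. Poly_Mapping.keys m \<subseteq> X \<and> (\<forall>v. Poly_Mapping.lookup m v \<le> e)}"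

lemma box_bij:
  assumes "finite X"
  shows "bij_betw (\<lambda>m. restrict (Poly_Mapping.lookup m) X) (box X e) (X \<rightarrow>\<^sub>E {..e})"
proof (rule bij_betw_byWitness[where f' = "\<lambda>g. Abs_poly_mapping (\<lambda>v. if v \<in> X then g v else 0)"])
  have fin: "finite {v. (if v \<in> X then g v else 0) \<noteq> (0::nat)}" for g
    by (rule finite_subset[OF _ assms]) auto
  have lk: "Poly_Mapping.lookup (Abs_poly_mapping (\<lambda>v. if v \<in> X then g v else 0)) w =
      (if w \<in> X then g w else (0::nat))" for g w
    by (subst lookup_Abs_poly_mapping[OF fin]) simp
  show "\<forall>m\<in>box X e. Abs_poly_mapping (\<lambda>v. if v \<in> X then restrict (Poly_Mapping.lookup m) X v else 0) = m"
  proof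
    fix m assume "m \<in> box X e"
    then show "Abs_poly_mapping (\<lambda>v. if v \<in> X then restrict (Poly_Mapping.lookup m) X v else 0) = m"
      by (intro poly_mapping_eqI) (auto simp: lk box_def in_keys_iff)
  qed
  show "\<forall>g\<in>X \<rightarrow>\<^sub>E {..e}. restrict (Poly_Mapping.lookup (Abs_poly_mapping (\<lambda>v. if v \<in> X then g v else 0))) X = g"
    by (auto simp: lk fun_eq_iff PiE_def extensional_def)
  show "(\<lambda>m. restrict (Poly_Mapping.lookup m) X) ` box X e \<subseteq> X \<rightarrow>\<^sub>E {..e}"
    by (auto simp: box_def)
  show "(\<lambda>g. Abs_poly_mapping (\<lambda>v. if v \<in> X then g v else 0)) ` (X \<rightarrow>\<^sub>E {..e}) \<subseteq> box X e"
    by (auto simp: box_def lk in_keys_iff split: if_splits)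
qed

lemma finite_box: "finite X \<Longrightarrow> finite (box X e)"
  using bij_betw_finite[OF box_bij] by (auto intro: finite_PiE)

lemma card_box: "finite X \<Longrightarrow> card (box X e) = (e + 1) ^ card X"
  using bij_betw_same_card[OF box_bij, of X e] by (simp add: card_PiE)

lemma box_mono: "e \<le> e' \<Longrightarrow> box X e \<subseteq> box X e'"
  unfolding box_def using order_trans by blast

lemma keys_mult_box:
  assumes "Poly_Mapping.keys p \<subseteq> box X e" "Poly_Mapping.keys q \<subseteq> box X e'"
  shows "Poly_Mapping.keys (p * q :: 'v mpol) \<subseteq> box X (e + e')"
proof
  fix m assume "m \<in> Poly_Mapping.keys (p * q)"
  then obtain a b where ab: "m = a + b" "a \<in> Poly_Mapping.keys p" "b \<in> Poly_Mapping.keys q"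
    using keys_mult[of p q] by blast
  then have "a \<in> box X e" "b \<in> box X e'" using assms by auto
  then show "m \<in> box X (e + e')"
    using keys_add[of a b] unfolding ab(1) box_def by (auto simp: lookup_add intro: add_mono)
qed

lemma keys_one_box: "Poly_Mapping.keys (1 :: 'v mpol) \<subseteq> box X 0"
  by (simp add: box_def)

lemma keys_power_box:
  "Poly_Mapping.keys p \<subseteq> box X e \<Longrightarrow> Poly_Mapping.keys (p ^ n :: 'v mpol) \<subseteq> box X (e * n)"
proof (induction n)
  case (Suc n)
  then show ?case using keys_mult_box[of p X e "p ^ n" "e * n"] by simp
qed (use keys_one_box in auto)

lemma keys_prod_box:
  assumes "\<And>i. i \<in> I \<Longrightarrow> Poly_Mapping.keys (f i) \<subseteq> box X (e i)"
  shows "Poly_Mapping.keys (\<Prod>i\<in>I. f i :: 'v mpol) \<subseteq> box X (\<Sum>i\<in>I. e i)"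
  using assms
proof (induction I rule: infinite_finite_induct)
  case (insert i I)
  then show ?case using keys_mult_box[of "f i" X "e i" "\<Prod>i\<in>I. f i" "\<Sum>i\<in>I. e i"] by simp
qed (use keys_one_box in auto)

lemma keys_in_common_box:
  assumes "finite D" "\<And>j. j \<in> D \<Longrightarrow> \<phi> j \<in> mpols_in X"
  shows "\<exists>e. \<forall>j\<in>D. Poly_Mapping.keys (\<phi> j) \<subseteq> box X e"
proof -
  let ?E = "\<Union>j\<in>D. \<Union>m\<in>Poly_Mapping.keys (\<phi> j). Poly_Mapping.lookup m ` Poly_Mapping.keys m"
  have "finite ?E" using assms(1) by auto
  then obtain e where e: "\<forall>x\<in>?E. x \<le> e" unfolding finite_nat_set_iff_bounded_le ..
  have "Poly_Mapping.lookup m v \<le> e" if "j \<in> D" "m \<in> Poly_Mapping.keys (\<phi> j)" for j m v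
  proof (cases "v \<in> Poly_Mapping.keys m")
    case True
    have "Poly_Mapping.lookup m v \<in> ?E"
      using that True by auto
    then show ?thesis using e by (rule bspec[rotated])
  qed (simp add: in_keys_iff)
  moreover have "Poly_Mapping.keys m \<subseteq> X" if "j \<in> D" "m \<in> Poly_Mapping.keys (\<phi> j)" for j m
    using assms(2)[OF that(1)] that(2) unfolding mpols_in_def by blast
  ultimately show ?thesis unfolding box_def by (intro exI[of _ e]) blast
qed

text \<open>More polynomials than variables are algebraically dependent. If all exponents of the \<open>\<phi> j\<close> are at
  most \<open>e\<close>, then a monomial in the \<open>\<phi> j\<close> with exponents at most \<open>b\<close> has exponents at most
  \<open>e * b * card D\<close>. There are \<open>(b + 1) ^ card D\<close> such monomials, and they lie in a space of dimension
  \<open>(e * b * card D + 1) ^ card X\<close>, which is smaller when \<open>b\<close> is large. Counting by exponents of the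
  single variables instead of total degree makes both numbers plain powers.\<close>

lemma algebraic_dependence:
  fixes \<phi> :: "'j \<Rightarrow> 'p mpol"
  assumes "finite X" "finite D" "card X < card D" "\<And>j. j \<in> D \<Longrightarrow> \<phi> j \<in> mpols_in X"
  shows "\<exists>Q. Q \<noteq> 0 \<and> Q \<in> mpols_in D \<and> (\<forall>x. mpol_eval Q (\<lambda>j. mpol_eval (\<phi> j) x) = 0)"
proof -
  obtain e where e: "\<And>j. j \<in> D \<Longrightarrow> Poly_Mapping.keys (\<phi> j) \<subseteq> box X e"
    using keys_in_common_box[of D \<phi> X] assms by blast
  define c where "c = e * card D + 1"
  \<comment> \<open>chosen so that \<open>(e * b * card D + 1) ^ card X \<le> (c * (b + 1)) ^ card X = b * (b + 1) ^ card X\<close>\<close>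
  define b where "b = c ^ card X"
  define E where "E = box D b"
  define F where "F = box X (e * b * card D)"
  define \<psi> where "\<psi> m = (\<Prod>j\<in>D. \<phi> j ^ Poly_Mapping.lookup m j)" for m
  have fin: "finite E" "finite F" using assms by (auto simp: E_def F_def finite_box)
  have \<psi>F: "Poly_Mapping.keys (\<psi> m) \<subseteq> F" if "m \<in> E" for m
  proof -
    have "Poly_Mapping.keys (\<psi> m) \<subseteq> box X (\<Sum>j\<in>D. e * Poly_Mapping.lookup m j)"
      unfolding \<psi>_def by (intro keys_prod_box keys_power_box e)
    also have "(\<Sum>j\<in>D. e * Poly_Mapping.lookup m j) \<le> (\<Sum>j\<in>D. e * b)"
      using that by (intro sum_mono) (auto simp: E_def box_def)
    also have "(\<Sum>j\<in>D. e * b) = e * b * card D" by simp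
    finally show ?thesis using box_mono by (auto simp: F_def)
  qed
  have "card F = (e * b * card D + 1) ^ card X"
    using assms(1) by (simp add: F_def card_box)
  also have "\<dots> \<le> (c * (b + 1)) ^ card X"
    by (rule power_mono) (auto simp: c_def algebra_simps)
  also have "\<dots> = b * (b + 1) ^ card X"
    unfolding power_mult_distrib b_def ..
  also have "\<dots> < (b + 1) * (b + 1) ^ card X"
    by (rule mult_strict_right_mono) auto
  also have "\<dots> = (b + 1) ^ Suc (card X)" by simp
  also have "\<dots> \<le> (b + 1) ^ card D"
    using assms(3) by (intro power_increasing) auto
  also have "\<dots> = card E" using assms(2) by (simp add: E_def card_box)
  finally have "card F < card E" .
  from linear_system_nontrivial_solution[OF fin(2,1) this, of "\<lambda>m. Poly_Mapping.lookup (\<psi> m)"]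
  obtain a :: "'j monom \<Rightarrow> complex" where a: "\<exists>m\<in>E. a m \<noteq> 0"
    "\<And>f. f \<in> F \<Longrightarrow> (\<Sum>m\<in>E. a m * Poly_Mapping.lookup (\<psi> m) f) = 0" by blast
  define Q where "Q = (\<Sum>m\<in>E. Poly_Mapping.single m (a m))"
  have lQ: "Poly_Mapping.lookup Q m = (if m \<in> E then a m else 0)" for m
    using fin by (simp add: Q_def lookup_sum lookup_single when_def sum.delta)
  have "Q \<noteq> 0"
  proof
    assume "Q = 0"
    then have "a m = 0" if "m \<in> E" for m using lQ[of m] that by simp
    then show False using a(1) by blast
  qed
  moreover have "Q \<in> mpols_in D"
  proof -
    have "Poly_Mapping.keys Q \<subseteq> E" by (auto simp: in_keys_iff lQ split: if_splits)
    then show ?thesis unfolding mpols_in_def E_def box_def by blast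
  qed
  moreover have "mpol_eval Q (\<lambda>j. mpol_eval (\<phi> j) x) = 0" for x
  proof -
    have ev: "monom_eval m (\<lambda>j. mpol_eval (\<phi> j) x) = mpol_eval (\<psi> m) x" if "m \<in> E" for m
      using that assms(2) unfolding \<psi>_def mpol_eval_prod mpol_eval_power
      by (intro monom_eval_superset) (auto simp: E_def box_def)
    have "mpol_eval Q (\<lambda>j. mpol_eval (\<phi> j) x) = (\<Sum>m\<in>E. a m * mpol_eval (\<psi> m) x)"
      by (simp add: Q_def mpol_eval_sum mpol_eval_single ev)
    also have "\<dots> = (\<Sum>m\<in>E. \<Sum>f\<in>F. a m * Poly_Mapping.lookup (\<psi> m) f * monom_eval f x)"
      by (intro sum.cong refl, subst mpol_eval_superset[OF fin(2) \<psi>F])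
        (simp_all add: sum_distrib_left mult.assoc)
    also have "\<dots> = (\<Sum>f\<in>F. (\<Sum>m\<in>E. a m * Poly_Mapping.lookup (\<psi> m) f) * monom_eval f x)"
      by (subst sum.swap) (simp add: sum_distrib_right)
    also have "\<dots> = 0" using a(2) by simp
    finally show ?thesis .
  qed
  ultimately show ?thesis by blast
qed

definition hom_part :: "nat \<Rightarrow> 'v mpol \<Rightarrow> 'v mpol" where
  "hom_part e Q = (\<Sum>m\<in>{m\<in>Poly_Mapping.keys Q. monom_deg m = e}. Poly_Mapping.single m (Poly_Mapping.lookup Q m))"

lemma lookup_hom_part:
  "Poly_Mapping.lookup (hom_part e Q) m = (if monom_deg m = e then Poly_Mapping.lookup Q m else 0)"
  by (auto simp: hom_part_def lookup_sum lookup_single when_def sum.delta in_keys_iff)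

lemma homogeneous_hom_part: "homogeneous e (hom_part e Q)"
  by (auto simp: homogeneous_def in_keys_iff lookup_hom_part split: if_splits)

lemma monom_eval_scale: "monom_eval m (\<lambda>v. t * x v) = t ^ monom_deg m * monom_eval m x"
  by (simp add: monom_eval_def monom_deg_def power_mult_distrib prod.distrib power_sum)

lemma mpol_eval_scale:
  assumes "homogeneous e p"
  shows "mpol_eval p (\<lambda>v. t * x v) = t ^ e * mpol_eval p x"
  using assms unfolding mpol_eval_def sum_distrib_left homogeneous_def
  by (intro sum.cong) (auto simp: monom_eval_scale)

text \<open>On a line through the origin, \<open>Q\<close> is a polynomial in the parameter, whose coefficients are the
  values of the homogeneous components.\<close>

lemma hom_part_vanishes_on_cone:
  assumes "\<And>t. mpol_eval Q (\<lambda>v. t * x v) = 0"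
  shows "mpol_eval (hom_part e Q) x = 0"
proof -
  define r where "r = (\<Sum>m\<in>Poly_Mapping.keys Q. Polynomial.monom (Poly_Mapping.lookup Q m * monom_eval m x) (monom_deg m))"
  have "poly r t = 0" for t
    using assms[of t] by (simp add: r_def poly_sum poly_monom mpol_eval_def monom_eval_scale mult_ac)
  then have "r = 0" using poly_all_0_iff_0[of r] by blast
  then have "0 = coeff r e" by simp
  also have "\<dots> = (\<Sum>m\<in>{m\<in>Poly_Mapping.keys Q. monom_deg m = e}. Poly_Mapping.lookup Q m * monom_eval m x)"
    by (simp add: r_def coeff_sum sum.inter_filter)
  also have "\<dots> = mpol_eval (hom_part e Q) x"
    by (simp add: hom_part_def mpol_eval_sum mpol_eval_single)
  finally show ?thesis by simp
qed

lemma nonzero_hom_part: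
  assumes "Q \<noteq> 0"
  shows "\<exists>e. hom_part e Q \<noteq> 0"
proof -
  obtain m where "Poly_Mapping.lookup Q m \<noteq> 0" using assms by (auto simp: poly_mapping_eq_iff fun_eq_iff)
  then have "Poly_Mapping.lookup (hom_part (monom_deg m) Q) m \<noteq> 0" by (simp add: lookup_hom_part)
  then have "hom_part (monom_deg m) Q \<noteq> 0" by auto
  then show ?thesis ..
qed

lemma mpol_eval_on_line:
  "\<exists>r. \<forall>t. poly r t = mpol_eval p (\<lambda>v. x v + t * y v)"
proof (intro exI allI)
  fix t
  show "poly (\<Sum>m\<in>Poly_Mapping.keys p. Polynomial.smult (Poly_Mapping.lookup p m)
      (\<Prod>v\<in>Poly_Mapping.keys m. [:x v, y v:] ^ Poly_Mapping.lookup m v)) t = mpol_eval p (\<lambda>v. x v + t * y v)"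
    by (simp add: poly_sum poly_prod poly_power mpol_eval_def monom_eval_def)
qed

text \<open>This replaces the irreducibility of a linear space: restricted to the line through \<open>x\<close> and \<open>y\<close>,
  both polynomials are nonzero polynomials in one variable, and so is their product.\<close>

lemma common_nonzero_on_line:
  assumes "mpol_eval p x \<noteq> 0" "mpol_eval q y \<noteq> 0"
  shows "\<exists>t. mpol_eval p (\<lambda>v. x v + t * (y v - x v)) \<noteq> 0 \<and> mpol_eval q (\<lambda>v. x v + t * (y v - x v)) \<noteq> 0"
proof -
  obtain r where r: "\<And>t. poly r t = mpol_eval (p * q) (\<lambda>v. x v + t * (y v - x v))"
    using mpol_eval_on_line[of "p * q" x "\<lambda>v. y v - x v"] by blast
  obtain a where a: "\<And>t. poly a t = mpol_eval p (\<lambda>v. x v + t * (y v - x v))"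
    using mpol_eval_on_line[of p x "\<lambda>v. y v - x v"] by blast
  obtain b where b: "\<And>t. poly b t = mpol_eval q (\<lambda>v. x v + t * (y v - x v))"
    using mpol_eval_on_line[of q x "\<lambda>v. y v - x v"] by blast
  have "poly a 0 \<noteq> 0" "poly b 1 \<noteq> 0" using assms by (simp_all add: a b)
  then have "a * b \<noteq> 0" by auto
  then obtain t where "poly (a * b) t \<noteq> 0" using poly_all_0_iff_0[of "a * b"] by blast
  then show ?thesis by (intro exI[of _ t]) (simp add: a b)
qed

section \<open>Counting monomials\<close>

definition monoms :: "'v set \<Rightarrow> nat \<Rightarrow> 'v monom set" where
  "monoms A e = {m. Poly_Mapping.keys m \<subseteq> A \<and> monom_deg m = e}"

text \<open>Exponent vectors of degree \<open>e\<close> are multisets of size \<open>e\<close>.\<close>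

lemma monoms_bij:
  "bij_betw (\<lambda>m. Abs_multiset (Poly_Mapping.lookup m)) (monoms A e) (multisets_of_size A e)"
proof -
  have fin: "finite {x. 0 < Poly_Mapping.lookup m x}" for m :: "'a monom"
    using finite_lookup[of m] by simp
  have cnt: "count (Abs_multiset (Poly_Mapping.lookup m)) = Poly_Mapping.lookup m" for m :: "'a monom"
    by (rule count_Abs_multiset[OF fin])
  have lk: "Poly_Mapping.lookup (Abs_poly_mapping (count M)) = count M" for M :: "'a multiset"
    by (rule lookup_Abs_poly_mapping) (simp add: set_mset_def[symmetric])
  have set: "set_mset (Abs_multiset (Poly_Mapping.lookup m)) = Poly_Mapping.keys m" for m :: "'a monom"
    by (auto simp: set_mset_def cnt in_keys_iff)
  have keys: "Poly_Mapping.keys (Abs_poly_mapping (count M)) = set_mset M" for M :: "'a multiset"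
    by (simp add: set_eq_iff in_keys_iff lk)
  show ?thesis
  proof (rule bij_betw_byWitness[where f' = "\<lambda>M. Abs_poly_mapping (count M)"])
    show "\<forall>m\<in>monoms A e. Abs_poly_mapping (count (Abs_multiset (Poly_Mapping.lookup m))) = m"
      by (simp add: cnt)
    show "\<forall>M\<in>multisets_of_size A e. Abs_multiset (Poly_Mapping.lookup (Abs_poly_mapping (count M))) = M"
      by (simp add: lk count_inverse)
    show "(\<lambda>m. Abs_multiset (Poly_Mapping.lookup m)) ` monoms A e \<subseteq> multisets_of_size A e"
      by (auto simp: monoms_def multisets_of_size_def set monom_deg_def size_multiset_overloaded_eq cnt)
    show "(\<lambda>M. Abs_poly_mapping (count M)) ` multisets_of_size A e \<subseteq> monoms A e"
      by (auto simp: monoms_def multisets_of_size_def keys monom_deg_def size_multiset_overloaded_eq lk)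
  qed
qed

lemma finite_monoms: "finite A \<Longrightarrow> finite (monoms A e)"
  using bij_betw_finite[OF monoms_bij] by blast

lemma card_monoms: "finite A \<Longrightarrow> card (monoms A e) = (card A + e - 1) choose e"
  using bij_betw_same_card[OF monoms_bij] card_multisets_of_size by metis

lemma monoms_mono: "A \<subseteq> B \<Longrightarrow> monoms A e \<subseteq> monoms B e"
  by (auto simp: monoms_def)

text \<open>After the first place where a convex function is nonnegative it would keep growing, so it could not
  come back to a value \<open>\<le> 0\<close> at \<open>K\<close>.\<close>

lemma convex_negative:
  fixes \<phi> :: "nat \<Rightarrow> int"
  assumes conv: "\<And>a. \<phi> (Suc a) - \<phi> a \<le> \<phi> (Suc (Suc a)) - \<phi> (Suc a)"
    and "\<phi> 0 < 0" "\<phi> K \<le> 0" "a < K"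
  shows "\<phi> a < 0"
proof (rule ccontr)
  assume "\<not> \<phi> a < 0"
  then have ex: "\<phi> a \<ge> 0" by simp
  define b where "b = (LEAST b. \<phi> b \<ge> 0)"
  have b: "\<phi> b \<ge> 0" "b \<le> a" unfolding b_def using ex by (auto intro: LeastI Least_le)
  then obtain c where c: "b = Suc c" using assms(2) by (cases b) auto
  then have "\<not> \<phi> c \<ge> 0" using not_less_Least[of c "\<lambda>b. \<phi> b \<ge> 0"] by (simp add: b_def)
  then have c0: "\<phi> (Suc c) - \<phi> c > 0" using b c by simp
  have inc: "\<phi> (Suc (c + j)) - \<phi> (c + j) > 0" for j
  proof (induction j)
    case (Suc j)
    then show ?case using conv[of "c + j"] by simp
  qed (use c0 in simp)
  have "\<phi> (b + j) \<ge> j" for j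
  proof (induction j)
    case (Suc j)
    then show ?case using inc[of "Suc j"] by (simp add: c)
  qed (use b in simp)
  from this[of "K - b"] show False using b assms(3,4) by simp
qed

lemma choose_second_difference:
  fixes a e :: nat
  assumes "e \<ge> 2"
  defines "N \<equiv> \<lambda>a. int ((a + e - 1) choose e)"
  shows "N (Suc (Suc a)) - 2 * N (Suc a) + N a = int ((a + e - 1) choose (e - 2))"
proof -
  obtain e' where e: "e = Suc (Suc e')" using assms(1) le_Suc_ex[of 2 e] by auto
  show ?thesis by (simp add: N_def e)
qed

text \<open>The left-hand side minus the right-hand side is the function \<open>\<phi>\<close> of the introduction, with
  \<open>K = k + 1\<close> and \<open>r = n - k\<close>. Its second difference is \<open>- 2\<close> from the quadratic term plus
  \<open>(a + d i - 1) choose (d i - 2)\<close> from each \<open>i\<close>. The sum of these is at least \<open>2\<close> because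
  there are two indices or the only degree is at least \<open>3\<close>; for one quadric the convexity fails.\<close>

lemma dimension_inequality:
  fixes d :: "nat \<Rightarrow> nat" and s K r a :: nat
  assumes "s \<ge> 1" "\<forall>i<s. d i \<ge> 2" "\<not> (s = 1 \<and> d 0 = 2)"
    and "K * r < (\<Sum>i<s. (K + d i - 1) choose d i)" "a < K"
  shows "(K - a) * (a + r) + (\<Sum>i<s. (a + d i - 1) choose d i) < (\<Sum>i<s. (K + d i - 1) choose d i)"
proof -
  define S where "S a = (\<Sum>i<s. int ((a + d i - 1) choose d i))" for a
  define \<phi> where "\<phi> b = (int K - int b) * (int b + int r) + S b - S K" for b
  \<comment> \<open>convexity: this outweighs the second difference \<open>- 2\<close> of the quadratic term\<close>
  have S2: "S (Suc (Suc b)) - 2 * S (Suc b) + S b \<ge> 2" for b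
  proof -
    have "S (Suc (Suc b)) - 2 * S (Suc b) + S b = (\<Sum>i<s. int ((b + d i - 1) choose (d i - 2)))"
    proof -
      have "S (Suc (Suc b)) - 2 * S (Suc b) + S b =
        (\<Sum>i<s. int ((Suc (Suc b) + d i - 1) choose d i) - 2 * int ((Suc b + d i - 1) choose d i)
          + int ((b + d i - 1) choose d i))"
        unfolding S_def by (simp only: sum_subtractf sum.distrib sum_distrib_left)
      also have "\<dots> = (\<Sum>i<s. int ((b + d i - 1) choose (d i - 2)))"
        using assms(2) by (intro sum.cong refl choose_second_difference) auto
      finally show ?thesis .
    qed
    also have "\<dots> \<ge> 2"
    proof (cases "s = 1")
      case True
      then have "d 0 \<ge> 2" "d 0 \<noteq> 2" using assms(2,3) by auto
      then have "3 \<le> d 0" by linarith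
      then obtain e where e: "d 0 = Suc (Suc (Suc e))"
        using le_Suc_ex[of 3 "d 0"] by auto
      have "0 < (b + Suc e) choose e" "0 < (b + Suc e) choose Suc e"
        by (simp_all add: zero_less_binomial_iff)
      then have "(Suc (b + Suc e)) choose Suc e \<ge> 2"
        unfolding binomial_Suc_Suc by linarith
      then show ?thesis by (simp add: True e)
    next
      case False
      then have "2 \<le> (\<Sum>i<s. 1 :: int)" using assms(1) by simp
      also have "\<dots> \<le> (\<Sum>i<s. int ((b + d i - 1) choose (d i - 2)))"
      proof (rule sum_mono)
        fix i assume "i \<in> {..<s}"
        have "0 < (b + d i - 1) choose (d i - 2)" by (rule zero_less_binomial) simp
        then show "1 \<le> int ((b + d i - 1) choose (d i - 2))" by linarith
      qed
      finally show ?thesis .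
    qed
    finally show ?thesis .
  qed
  have S0: "S 0 = 0" unfolding S_def 
  proof (rule sum.neutral, rule ballI)
    fix i assume "i \<in> {..<s}"
    then have "d i \<ge> 2" using assms(2) by blast
    then show "int ((0 + d i - 1) choose d i) = 0" by (simp add: binomial_eq_0)
  qed
  have "\<phi> a < 0"
  proof (rule convex_negative[of \<phi> K])
    show "\<phi> (Suc b) - \<phi> b \<le> \<phi> (Suc (Suc b)) - \<phi> (Suc b)" for b
      using S2[of b] by (simp add: \<phi>_def algebra_simps)
    have "int (K * r) < S K" using assms(4) unfolding S_def by (simp only: of_nat_less_iff flip: of_nat_sum)
    then show "\<phi> 0 < 0" by (simp add: \<phi>_def S0)
    show "\<phi> K \<le> 0" by (simp add: \<phi>_def)
  qed (rule assms(5))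
  then have "(int K - int a) * (int a + int r) + S a < S K" by (simp add: \<phi>_def)
  also have "(int K - int a) * (int a + int r) = int ((K - a) * (a + r))"
    using assms(5) by (simp add: of_nat_diff)
  finally have "int ((K - a) * (a + r) + (\<Sum>i<s. (a + d i - 1) choose d i))
      < int (\<Sum>i<s. (K + d i - 1) choose d i)"
    unfolding S_def by simp
  then show ?thesis by (simp only: of_nat_less_iff)
qed

section \<open>Coordinates adapted to a plane and charts around it\<close>

text \<open>The linear map with columns \<open>u 0, \<dots>, u n\<close>.\<close>

definition lin :: "nat \<Rightarrow> (nat \<Rightarrow> nat \<Rightarrow> complex) \<Rightarrow> (nat \<Rightarrow> complex) \<Rightarrow> nat \<Rightarrow> complex" where
  "lin n u y = (\<lambda>v. \<Sum>j\<le>n. y j * u j v)"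

lemma lin_Aff:
  assumes "\<And>j. j \<le> n \<Longrightarrow> u j \<in> Aff m"
  shows "lin n u y \<in> Aff m"
  using assms by (auto simp: lin_def Aff_def intro!: sum.neutral)

lemma lin_lin: "lin n u (lin m w y) = lin m (\<lambda>j. lin n u (w j)) y"
proof
  fix v
  have "lin n u (lin m w y) v = (\<Sum>j\<le>n. \<Sum>i\<le>m. y i * w i j * u j v)"
    by (simp add: lin_def sum_distrib_right)
  also have "\<dots> = (\<Sum>i\<le>m. \<Sum>j\<le>n. y i * w i j * u j v)" by (rule sum.swap)
  also have "\<dots> = lin m (\<lambda>j. lin n u (w j)) y v"
    by (simp add: lin_def sum_distrib_left mult.assoc)
  finally show "lin n u (lin m w y) v = lin m (\<lambda>j. lin n u (w j)) y v" .
qed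

definition unit :: "nat \<Rightarrow> nat \<Rightarrow> complex" where
  "unit i = (\<lambda>v. if v = i then 1 else 0)"

lemma unit_in_Aff: "i \<le> n \<Longrightarrow> unit i \<in> Aff n"
  by (auto simp: unit_def Aff_def)

lemma lin_unit: "y \<in> Aff n \<Longrightarrow> lin n unit y = y"
  by (auto simp: lin_def unit_def Aff_def fun_eq_iff if_distrib[of "\<lambda>c. _ * c"] not_le cong: if_cong)

lemma lin_of_unit: "i \<le> n \<Longrightarrow> lin n u (unit i) = u i"
  by (auto simp: lin_def unit_def fun_eq_iff if_distrib[of "\<lambda>c. c * _"] cong: if_cong)

lemma lin_eq_sum: "lin n u y = (\<Sum>j\<le>n. vscale (y j) (u j))"
proof
  fix v
  have "(\<Sum>j\<in>S. vscale (y j) (u j)) v = (\<Sum>j\<in>S. y j * u j v)" if "finite S" for S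
    using that by (induction S rule: finite_induct) (auto simp: vscale_def)
  from this[of "{..n}"] show "lin n u y v = (\<Sum>j\<le>n. vscale (y j) (u j)) v"
    by (simp add: lin_def)
qed

lemma lin_in_subspace:
  assumes "vs.subspace W" "\<And>j. j \<le> n \<Longrightarrow> u j \<in> W"
  shows "lin n u y \<in> W"
  unfolding lin_eq_sum using assms by (intro vs.subspace_sum vs.subspace_scale) auto

lemma subspace_Aff: "vs.subspace (Aff n)"
  by (auto simp: vs.subspace_def Aff_def vscale_def)

lemma unit_inj: "inj unit"
  by (auto simp: inj_def unit_def fun_eq_iff)

text \<open>Together with \<open>span_unit\<close> this says that \<open>Aff n\<close> has dimension \<open>n + 1\<close>, which bounds the size of the
  bases chosen below.\<close>

lemma independent_unit: "vs.independent (unit ` {..n})"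
proof -
  have inj: "inj_on unit {..n}" using unit_inj by (rule inj_on_subset) simp
  have "c (unit i) = 0" if z: "(\<Sum>v\<in>unit ` {..n}. vscale (c v) v) = 0" and i: "i \<le> n" for c i
  proof -
    have "0 = lin n unit (\<lambda>j. c (unit j)) i"
      unfolding lin_eq_sum using z by (simp add: sum.reindex[OF inj])
    also have "\<dots> = c (unit i)" using i by (simp add: lin_def unit_def if_distrib cong: if_cong)
    finally show ?thesis by simp
  qed
  then show ?thesis by (auto simp: vs.dependent_finite)
qed

lemma span_unit: "vs.span (unit ` {..n}) = Aff n"
proof
  show "vs.span (unit ` {..n}) \<subseteq> Aff n"
    by (rule vs.span_minimal) (auto intro: unit_in_Aff subspace_Aff)
  show "Aff n \<subseteq> vs.span (unit ` {..n})"
  proof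
    fix y assume "y \<in> Aff n"
    then have "y = lin n unit y" by (simp add: lin_unit)
    also have "\<dots> \<in> vs.span (unit ` {..n})"
      by (rule lin_in_subspace) (auto intro: vs.subspace_span vs.span_base)
    finally show "y \<in> vs.span (unit ` {..n})" .
  qed
qed

lemma basis_enumeration:
  assumes "finite b" "card b = n + 1" "bij_betw u {..n} b"
  shows "vs.span b = lin n u ` UNIV"
proof
  have inj: "inj_on u {..n}" and b: "b = u ` {..n}" using assms(3) by (auto simp: bij_betw_def)
  show "lin n u ` UNIV \<subseteq> vs.span b"
    by (auto intro!: lin_in_subspace intro: vs.span_base simp: b)
  show "vs.span b \<subseteq> lin n u ` UNIV"
  proof
    fix x assume "x \<in> vs.span b"
    then obtain c where "x = (\<Sum>v\<in>b. vscale (c v) v)" using vs.span_finite[OF assms(1)] by auto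
    then have "x = lin n u (\<lambda>j. c (u j))"
      unfolding lin_eq_sum by (simp add: b sum.reindex[OF inj])
    then show "x \<in> lin n u ` UNIV" by blast
  qed
qed

definition mutually_inverse :: "nat \<Rightarrow> (nat \<Rightarrow> nat \<Rightarrow> complex) \<Rightarrow> (nat \<Rightarrow> nat \<Rightarrow> complex) \<Rightarrow> bool" where
  "mutually_inverse n u \<beta> \<longleftrightarrow> (\<forall>j. u j \<in> Aff n \<and> \<beta> j \<in> Aff n) \<and>
     (\<forall>x\<in>Aff n. lin n u (lin n \<beta> x) = x \<and> lin n \<beta> (lin n u x) = x)"

text \<open>A basis of \<open>W\<close> is extended to a basis \<open>u\<close> of \<open>Aff n\<close>. The second matrix \<open>\<beta>\<close>
  gives the coordinates with respect to \<open>u\<close>. In these coordinates \<open>W\<close> is the space \<open>Aff k\<close>, so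
  every plane \<open>\<Lambda>'\<close> can be treated as the first coordinate plane.\<close>

lemma adapted_basis:
  assumes W: "vs.subspace W" "W \<subseteq> Aff n" "vs.dim W = k + 1" and "k \<le> n"
  shows "\<exists>u \<beta>. mutually_inverse n u \<beta> \<and> W = lin n u ` Aff k"
proof -
  obtain b0 where b0: "b0 \<subseteq> W" "vs.independent b0" "W \<subseteq> vs.span b0" "card b0 = k + 1"
    using vs.basis_exists[of W] W(3) by metis
  obtain b where b: "b0 \<subseteq> b" "b \<subseteq> Aff n" "vs.independent b" "Aff n \<subseteq> vs.span b"
    using vs.maximal_independent_subset_extend[of b0 "Aff n"] b0 W by blast
  have sb: "vs.span b = Aff n"
    using b(2,4) vs.span_minimal[OF b(2) subspace_Aff] by blast
  have finb: "finite b"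
    using vs.independent_span_bound[of "unit ` {..n}" b] b(2,3) by (simp add: span_unit)
  have cb: "card b = n + 1"
  proof -
    have "card b = vs.dim (Aff n)" using vs.basis_card_eq_dim[of b "Aff n"] b by blast
    also have "\<dots> = card (unit ` {..n})"
      using vs.basis_card_eq_dim[of "unit ` {..n}" "Aff n"] independent_unit[of n]
      by (metis span_unit vs.span_superset order_refl)
    also have "\<dots> = n + 1" using card_image[of unit "{..n}"] inj_on_subset[OF unit_inj] by auto
    finally show ?thesis .
  qed
  have fin0: "finite b0" using finb b(1) by (rule finite_subset[rotated])
  have "\<exists>g. bij_betw g {..k} b0"
    using b0(4) fin0 by (intro finite_same_card_bij) auto
  then obtain g0 where g0: "bij_betw g0 {..k} b0" by blast
  have "card {Suc k..n} = card (b - b0)"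
    using card_Diff_subset[OF fin0 b(1)] cb b0(4) by simp
  then have "\<exists>g. bij_betw g {Suc k..n} (b - b0)"
    using finb by (intro finite_same_card_bij) auto
  then obtain g1 where g1: "bij_betw g1 {Suc k..n} (b - b0)" by blast
  define u where "u j = (if j \<le> k then g0 j else if j \<le> n then g1 j else 0)" for j
  have u0: "bij_betw u {..k} b0"
    using g0 by (rule bij_betw_cong[THEN iffD1, rotated]) (simp add: u_def)
  have u1: "bij_betw u {Suc k..n} (b - b0)"
    using g1 by (rule bij_betw_cong[THEN iffD1, rotated]) (auto simp: u_def)
  have "bij_betw u ({..k} \<union> {Suc k..n}) (b0 \<union> (b - b0))"
    by (rule bij_betw_combine[OF u0 u1]) auto
  moreover have "{..k} \<union> {Suc k..n} = {..n}" using assms(4) by auto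
  moreover have "b0 \<union> (b - b0) = b" using b(1) by auto
  ultimately have ub: "bij_betw u {..n} b" by simp
  then have inj: "inj_on u {..n}" and bu: "b = u ` {..n}" by (auto simp: bij_betw_def)
  have uA: "u j \<in> Aff n" for j
  proof (cases "j \<le> n")
    case True
    then show ?thesis using bu b(2) by auto
  next
    case False
    then show ?thesis using assms(4) by (auto simp: u_def Aff_def)
  qed
  have surj: "\<exists>y. lin n u y = x" if "x \<in> Aff n" for x
  proof -
    have "x \<in> range (lin n u)" using that basis_enumeration[OF finb cb ub] sb by simp
    then show ?thesis by auto
  qed
  have kernel: "y j = 0" if "lin n u y = 0" "j \<le> n" for y j
  proof -
    let ?c = "\<lambda>x. y (inv_into {..n} u x)"
    have "(\<Sum>v\<in>b. vscale (?c v) v) = (\<Sum>j\<le>n. vscale (y j) (u j))"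
      unfolding bu sum.reindex[OF inj] comp_def by (intro sum.cong refl) (simp add: inv_into_f_f[OF inj])
    also have "\<dots> = 0" using that(1) by (simp add: lin_eq_sum)
    finally have z: "(\<Sum>v\<in>b. vscale (?c v) v) = 0" .
    have ub: "u j \<in> b" using bu that(2) by auto
    have "\<not> (\<exists>c. (\<exists>v\<in>b. c v \<noteq> 0) \<and> (\<Sum>v\<in>b. vscale (c v) v) = 0)"
      using b(3) unfolding vs.dependent_finite[OF finb] .
    then have "\<not> ((\<exists>v\<in>b. ?c v \<noteq> 0) \<and> (\<Sum>v\<in>b. vscale (?c v) v) = 0)"
      by (rule contrapos_nn) (rule exI)
    then have "?c (u j) = 0" using z ub by auto
    then show ?thesis using that(2) by (simp add: inv_into_f_f[OF inj])
  qed
  define \<beta> where "\<beta> i = (if i \<le> n then (\<lambda>j. if j \<le> n then (SOME y. lin n u y = unit i) j else 0) else 0)" for i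
  have lincut: "lin n u (\<lambda>j. if j \<le> n then y j else 0) = lin n u y" for y
    by (auto simp: lin_def)
  have \<beta>: "lin n u (\<beta> i) = unit i" if "i \<le> n" for i
    using someI_ex[OF surj[OF unit_in_Aff[OF that]]] that by (simp add: \<beta>_def lincut)
  have \<beta>A: "\<beta> j \<in> Aff n" for j by (auto simp: \<beta>_def Aff_def)
  have inv1: "lin n u (lin n \<beta> x) = x" if "x \<in> Aff n" for x
  proof -
    have "lin n u (lin n \<beta> x) = lin n unit x"
      unfolding lin_lin unfolding lin_eq_sum[of n _ x] by (intro sum.cong refl) (simp add: \<beta>)
    then show ?thesis using that by (simp add: lin_unit)
  qed
  have inv2: "lin n \<beta> (lin n u x) = x" if "x \<in> Aff n" for x
  proof
    fix j
    let ?z = "lin n \<beta> (lin n u x)"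
    have "lin n u (\<lambda>j. ?z j - x j) = lin n u ?z - lin n u x"
      by (auto simp: lin_def fun_eq_iff left_diff_distrib sum_subtractf)
    also have "\<dots> = 0" using inv1[OF lin_Aff[of n u n x]] uA by simp
    finally have "j \<le> n \<Longrightarrow> ?z j - x j = 0" using kernel by blast
    moreover have "j > n \<Longrightarrow> ?z j = 0 \<and> x j = 0"
      using lin_Aff[of n \<beta> n "lin n u x"] \<beta>A that by (auto simp: Aff_def)
    ultimately show "?z j = x j" by (cases "j \<le> n") auto
  qed
  have "W = vs.span b0"
    using b0 vs.span_minimal[OF b0(1) W(1)] by blast
  also have "\<dots> = lin k u ` UNIV" by (rule basis_enumeration[OF fin0 b0(4) u0])
  also have "\<dots> = lin n u ` Aff k"
  proof
    have *: "lin k u y = lin n u (\<lambda>j. if j \<le> k then y j else 0)" for y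
      unfolding lin_def fun_eq_iff using assms(4)
      by (intro allI sum.mono_neutral_cong_left) auto
    show "lin k u ` UNIV \<subseteq> lin n u ` Aff k"
      unfolding * by (auto simp: Aff_def)
    have "lin n u y = lin k u y" if "y \<in> Aff k" for y
    proof -
      have "(\<lambda>j. if j \<le> k then y j else 0) = y" using that by (auto simp: Aff_def)
      then show ?thesis using *[of y] by simp
    qed
    then show "lin n u ` Aff k \<subseteq> lin k u ` UNIV" by auto
  qed
  finally show ?thesis using uA \<beta>A inv1 inv2 unfolding mutually_inverse_def by blast
qed

text \<open>The rows of a reduced echelon form with pivot columns \<open>C\<close>. The pivot order is chosen relative to
  \<open>Aff k\<close>: a row with pivot at most \<open>k\<close> has all its entries there, because it lies in the
  intersection with \<open>Aff k\<close>.\<close>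

definition chart_vector :: "nat \<Rightarrow> nat \<Rightarrow> nat set \<Rightarrow> (nat \<Rightarrow> nat \<Rightarrow> complex) \<Rightarrow> nat \<Rightarrow> nat \<Rightarrow> complex" where
  "chart_vector n k C N i = (\<lambda>v. if v = i then 1
     else if v \<le> n \<and> v \<notin> C \<and> (i \<le> k \<longrightarrow> v \<le> k) then N i v else 0)"

text \<open>Let \<open>Y\<close> be the image of \<open>\<gamma>\<close>. The non-pivots form a maximal set of coordinates whose
  coordinate subspace meets \<open>Y\<close> only in zero, and
  this set is built in two steps: first it is maximal among the subsets of \<open>{..k}\<close>, then it is
  enlarged to a maximal subset of \<open>{..n}\<close>. Adding one more coordinate \<open>i\<close> to a maximal set
  produces a nonzero vector of \<open>Y\<close> supported there, hence with nonzero \<open>i\<close>-th coordinate;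
  rescaled, it is the row with pivot \<open>i\<close>. For \<open>i \<le> k\<close> the first step already produces such a
  vector, and this is why the row stays inside \<open>Aff k\<close>.\<close>

lemma subspace_has_chart:
  assumes \<gamma>: "\<And>j. \<gamma> j \<in> Aff n"
    and inj: "\<And>y. y \<in> Aff k \<Longrightarrow> lin k \<gamma> y = 0 \<Longrightarrow> y = 0"
    and "k \<le> n"
  shows "\<exists>C N. C \<subseteq> {..n} \<and> card C = k + 1 \<and> (\<forall>i\<in>C. chart_vector n k C N i \<in> lin k \<gamma> ` Aff k)"
proof -
  define Y where "Y = lin k \<gamma> ` Aff k"
  have YA: "y \<in> Aff n" if "y \<in> Y" for y using that lin_Aff[of k \<gamma> n] \<gamma> by (auto simp: Y_def)
  have Yscale: "(\<lambda>v. c * y v) \<in> Y" if yY: "y \<in> Y" for y c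
  proof -
    obtain z where z: "z \<in> Aff k" "y = lin k \<gamma> z" using yY unfolding Y_def by blast
    then have "(\<lambda>v. c * y v) = lin k \<gamma> (\<lambda>j. c * z j)"
      by (simp add: lin_def sum_distrib_left mult.assoc)
    moreover have "(\<lambda>j. c * z j) \<in> Aff k" using z by (auto simp: Aff_def)
    ultimately show ?thesis by (auto simp: Y_def)
  qed
  \<comment> \<open>\<open>Y\<close> meets the coordinate subspace of \<open>B\<close> only in zero\<close>
  define good where "good B \<longleftrightarrow> (\<forall>y\<in>Y. (\<forall>j. j \<notin> B \<longrightarrow> y j = 0) \<longrightarrow> y = 0)" for B
  have good0: "good {}" by (auto simp: good_def)
  have pivot: "\<exists>y\<in>Y. y i = 1 \<and> (\<forall>j. j \<notin> insert i B \<longrightarrow> y j = 0)"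
    if gB: "good B" "\<not> good (insert i B)" for B i
  proof -
    obtain y where y: "y \<in> Y" "\<forall>j. j \<notin> insert i B \<longrightarrow> y j = 0" "y \<noteq> 0"
      using gB(2) by (auto simp: good_def)
    have "y i \<noteq> 0"
    proof
      assume "y i = 0"
      then have "y j = 0" if "j \<notin> B" for j using y(2) that by (cases "j = i") auto
      then show False using gB(1) y(1,3) unfolding good_def by blast
    qed
    then show ?thesis using Yscale[OF y(1), of "1 / y i"] y(2)
      by (intro bexI[of _ "\<lambda>v. 1 / y i * y v"]) auto
  qed
  have "finite {B. B \<subseteq> {..k} \<and> good B}" by (rule finite_subset[of _ "Pow {..k}"]) auto
  then obtain B1 where B1: "B1 \<subseteq> {..k}" "good B1"
    and max1: "\<And>B. B \<subseteq> {..k} \<Longrightarrow> good B \<Longrightarrow> B1 \<subseteq> B \<Longrightarrow> B1 = B"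
    using finite_has_maximal2[of "{B. B \<subseteq> {..k} \<and> good B}" "{}"] good0 by auto
  have "finite {B. B \<subseteq> {..n} \<and> good B}" by (rule finite_subset[of _ "Pow {..n}"]) auto
  moreover have "B1 \<in> {B. B \<subseteq> {..n} \<and> good B}" using B1 assms(3) by auto
  ultimately obtain B2 where B2: "B2 \<subseteq> {..n}" "good B2" "B1 \<subseteq> B2"
    and max2: "\<And>B. B \<subseteq> {..n} \<Longrightarrow> good B \<Longrightarrow> B2 \<subseteq> B \<Longrightarrow> B2 = B"
    using finite_has_maximal2[of "{B. B \<subseteq> {..n} \<and> good B}" B1] by auto
  define C where "C = {..n} - B2"
  have "\<exists>y\<in>Y. y i = 1 \<and> (\<forall>j. j \<noteq> i \<longrightarrow> \<not> (j \<le> n \<and> j \<notin> C \<and> (i \<le> k \<longrightarrow> j \<le> k)) \<longrightarrow> y j = 0)"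
    if i: "i \<in> C" for i
  proof (cases "i \<le> k")
    case True
    have "i \<notin> B1" using i B2(3) by (auto simp: C_def)
    then have "\<not> good (insert i B1)" using max1[of "insert i B1"] B1(1) True by auto
    from pivot[OF B1(2) this] obtain y where y: "y \<in> Y" "y i = 1" "\<forall>j. j \<notin> insert i B1 \<longrightarrow> y j = 0"
      by blast
    have "y j = 0" if "j \<noteq> i" "\<not> (j \<le> n \<and> j \<notin> C \<and> (i \<le> k \<longrightarrow> j \<le> k))" for j
    proof -
      have "j \<notin> B1" using that True B1(1) B2 by (auto simp: C_def)
      then show ?thesis using y(3) that(1) by simp
    qed
    then show ?thesis using y by blast
  next
    case False
    have "\<not> good (insert i B2)" using max2[of "insert i B2"] B2(1) i by (auto simp: C_def)
    from pivot[OF B2(2) this] obtain y where y: "y \<in> Y" "y i = 1" "\<forall>j. j \<notin> insert i B2 \<longrightarrow> y j = 0"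
      by blast
    have "y j = 0" if "j \<noteq> i" "\<not> (j \<le> n \<and> j \<notin> C \<and> (i \<le> k \<longrightarrow> j \<le> k))" for j
    proof -
      have "j \<notin> B2" using that False B2(1) by (auto simp: C_def)
      then show ?thesis using y(3) that(1) by simp
    qed
    then show ?thesis using y by blast
  qed
  then have "\<forall>i\<in>C. \<exists>y. y \<in> Y \<and> y i = 1 \<and>
      (\<forall>j. j \<noteq> i \<longrightarrow> \<not> (j \<le> n \<and> j \<notin> C \<and> (i \<le> k \<longrightarrow> j \<le> k)) \<longrightarrow> y j = 0)"
    by blast
  from bchoice[OF this] obtain N where N: "\<And>i. i \<in> C \<Longrightarrow> N i \<in> Y \<and> N i i = 1 \<and>
      (\<forall>j. j \<noteq> i \<longrightarrow> \<not> (j \<le> n \<and> j \<notin> C \<and> (i \<le> k \<longrightarrow> j \<le> k)) \<longrightarrow> N i j = 0)"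
    by blast
  have cvN: "chart_vector n k C N i = N i" if "i \<in> C" for i
    using N[OF that] by (auto simp: chart_vector_def fun_eq_iff)
  have finC: "finite C" by (simp add: C_def)
  \<comment> \<open>with fewer pivots, a nonzero vector of \<open>Y\<close> would vanish in all pivot columns\<close>
  have "\<not> card C < card {..k}"
  proof
    assume "card C < card {..k}"
    from linear_system_nontrivial_solution[OF finC _ this, of \<gamma>] obtain c
      where c: "\<exists>j\<le>k. c j \<noteq> 0" "\<And>v. v \<in> C \<Longrightarrow> (\<Sum>j\<le>k. c j * \<gamma> j v) = 0" by auto
    define y where "y j = (if j \<le> k then c j else 0)" for j
    have yA: "y \<in> Aff k" by (auto simp: y_def Aff_def)
    have ly: "lin k \<gamma> y v = (\<Sum>j\<le>k. c j * \<gamma> j v)" for v by (auto simp: lin_def y_def)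
    have "lin k \<gamma> y j = 0" if "j \<notin> B2" for j
    proof (cases "j \<le> n")
      case True
      then show ?thesis using that c(2) ly by (simp add: C_def)
    next
      case False
      then show ?thesis using YA[of "lin k \<gamma> y"] yA by (auto simp: Y_def Aff_def)
    qed
    then have "lin k \<gamma> y = 0" using B2(2) yA by (auto simp: good_def Y_def)
    then have "y = 0" using inj yA by blast
    then show False using c(1) by (auto simp: y_def fun_eq_iff split: if_splits)
  qed
  \<comment> \<open>with more pivots, the rows would be linearly dependent, but they are not in the pivot columns\<close>
  moreover have "\<not> card {..k} < card C"
  proof
    assume less: "card {..k} < card C"
    have "\<exists>z. z \<in> Aff k \<and> N i = lin k \<gamma> z" if "i \<in> C" for i using N[OF that] by (auto simp: Y_def)
    then obtain z where z: "\<And>i. i \<in> C \<Longrightarrow> N i = lin k \<gamma> (z i)" by metis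
    from linear_system_nontrivial_solution[OF _ finC less, of z] obtain c
      where c: "\<exists>i\<in>C. c i \<noteq> 0" "\<And>j. j \<le> k \<Longrightarrow> (\<Sum>i\<in>C. c i * z i j) = 0" by auto
    have comb: "(\<Sum>i\<in>C. c i * N i v) = 0" for v
    proof -
      have "(\<Sum>i\<in>C. c i * N i v) = (\<Sum>i\<in>C. \<Sum>j\<le>k. c i * z i j * \<gamma> j v)"
        by (intro sum.cong refl) (simp add: z lin_def sum_distrib_left mult.assoc)
      also have "\<dots> = (\<Sum>j\<le>k. (\<Sum>i\<in>C. c i * z i j) * \<gamma> j v)"
        by (subst sum.swap) (simp add: sum_distrib_right)
      also have "\<dots> = 0" using c(2) by simp
      finally show ?thesis .
    qed
    have "c i = 0" if "i \<in> C" for i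
    proof -
      have "(\<Sum>l\<in>C. c l * N l i) = (\<Sum>l\<in>C. if l = i then c i else 0)"
        using N that by (intro sum.cong refl) auto
      then show ?thesis using comb[of i] finC that by simp
    qed
    then show False using c(1) by blast
  qed
  ultimately have "card C = k + 1" by simp
  then show ?thesis using cvN N by (intro exI[of _ C] exI[of _ N]) (auto simp: C_def Y_def)
qed

section \<open>Substitution, interpolation and shears\<close>

lemma Hom_iff: "p \<in> Hom n e \<longleftrightarrow> homogeneous e p \<and> p \<in> mpols_in {..n}"
  by (simp add: Hom_def mpols_in_def)

lemma keys_Hom: "p \<in> Hom n e \<Longrightarrow> Poly_Mapping.keys p \<subseteq> monoms {..n} e"
  by (auto simp: Hom_def homogeneous_def monoms_def)

lemma Hom_linear_substitution:
  assumes "p \<in> Hom n e"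
  shows "\<exists>h\<in>Hom n e. \<forall>y. mpol_eval h y = mpol_eval p (lin n w y)"
proof -
  define \<sigma> where "\<sigma> v = (\<Sum>j\<le>n. Poly_Mapping.single 0 (w j v) * var j)" for v
  have "homogeneous 1 (\<sigma> v)" for v
    unfolding \<sigma>_def
    using homogeneous_mult[OF homogeneous_const homogeneous_var] by (intro homogeneous_sum) simp
  moreover have "\<sigma> v \<in> mpols_in {..n}" for v
    unfolding \<sigma>_def by (intro mpols_in_sum mpols_in_mult mpols_in_const mpols_in_var)
  ultimately have "msubst \<sigma> p \<in> Hom n e"
    using assms homogeneous_msubst mpols_in_msubst unfolding Hom_iff by blast
  moreover have "mpol_eval (\<sigma> v) y = lin n w y v" for v y
    by (simp add: \<sigma>_def lin_def mpol_eval_sum mpol_eval_mult mpol_eval_const mult.commute)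
  then have "mpol_eval (msubst \<sigma> p) y = mpol_eval p (lin n w y)" for y
    by (simp add: mpol_eval_msubst)
  ultimately show ?thesis by blast
qed

lemma monom_eval_off_support:
  assumes "\<not> Poly_Mapping.keys m \<subseteq> C" "\<And>v. v \<notin> C \<Longrightarrow> y v = 0"
  shows "monom_eval m y = 0"
proof -
  obtain v where v: "v \<in> Poly_Mapping.keys m" "v \<notin> C" using assms(1) by blast
  then have "y v ^ Poly_Mapping.lookup m v = 0" using assms(2) by (simp add: in_keys_iff)
  then show ?thesis unfolding monom_eval_def using v(1) by (intro prod_zero) auto
qed

lemma monom_eval_cong:
  assumes "\<And>v. v \<in> Poly_Mapping.keys m \<Longrightarrow> x v = y v"
  shows "monom_eval m x = monom_eval m y"
  unfolding monom_eval_def by (rule prod.cong) (simp_all add: assms)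

lemma mpol_eval_cong:
  assumes "p \<in> mpols_in X" "\<And>v. v \<in> X \<Longrightarrow> x v = y v"
  shows "mpol_eval p x = mpol_eval p y"
  unfolding mpol_eval_def
proof (rule sum.cong[OF refl])
  fix m assume "m \<in> Poly_Mapping.keys p"
  then have "monom_eval m x = monom_eval m y"
    using assms by (intro monom_eval_cong) (auto simp: mpols_in_def)
  then show "Poly_Mapping.lookup p m * monom_eval m x = Poly_Mapping.lookup p m * monom_eval m y" by simp
qed

text \<open>Restricted to the coordinate subspace of \<open>C\<close>, the monomials supported in \<open>C\<close> stay linearly
  independent and all other monomials vanish.\<close>

lemma vanishing_on_coordinate_subspace:
  assumes "\<And>y. (\<And>v. v \<notin> C \<Longrightarrow> y v = 0) \<Longrightarrow> mpol_eval h y = 0" "m \<in> Poly_Mapping.keys h"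
  shows "\<not> Poly_Mapping.keys m \<subseteq> C"
proof
  assume mC: "Poly_Mapping.keys m \<subseteq> C"
  let ?E = "{l \<in> Poly_Mapping.keys h. Poly_Mapping.keys l \<subseteq> C}"
  have "(\<Sum>l\<in>?E. Poly_Mapping.lookup h l * monom_eval l x) = 0" for x
  proof -
    define y where "y v = (if v \<in> C then x v else 0)" for v
    have "0 = mpol_eval h y" using assms(1)[of y] by (simp add: y_def)
    also have "\<dots> = (\<Sum>l\<in>?E. Poly_Mapping.lookup h l * monom_eval l y)"
      unfolding mpol_eval_def
    proof (rule sum.mono_neutral_right)
      have "monom_eval l y = 0" if "\<not> Poly_Mapping.keys l \<subseteq> C" for l
        by (rule monom_eval_off_support[OF that]) (simp add: y_def)
      then show "\<forall>l\<in>Poly_Mapping.keys h - ?E. Poly_Mapping.lookup h l * monom_eval l y = 0" by simp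
    qed auto
    also have "\<dots> = (\<Sum>l\<in>?E. Poly_Mapping.lookup h l * monom_eval l x)"
    proof (rule sum.cong[OF refl])
      fix l assume "l \<in> ?E"
      then have "monom_eval l y = monom_eval l x"
        by (intro monom_eval_cong) (auto simp: y_def)
      then show "Poly_Mapping.lookup h l * monom_eval l y = Poly_Mapping.lookup h l * monom_eval l x" by simp
    qed
    finally show ?thesis by simp
  qed
  then have "Poly_Mapping.lookup h m = 0"
    using monomials_linearly_independent[of ?E "Poly_Mapping.lookup h" m] mC assms(2) by simp
  then show False using assms(2) by (simp add: in_keys_iff)
qed

text \<open>The points are found one at a time. As long as there are fewer points than functions, some nonzero
  combination of the functions vanishes at all chosen points; a point where it does not vanish can be added,
  and a multiple of this combination adjusts the value there without changing the others.\<close>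

lemma interpolation_points:
  fixes g :: "'e \<Rightarrow> 'x \<Rightarrow> 'k::field"
  assumes "finite E"
    and indep: "\<And>c. \<forall>x\<in>X. (\<Sum>m\<in>E. c m * g m x) = 0 \<Longrightarrow> \<forall>m\<in>E. c m = 0"
  obtains P where "P \<subseteq> X" "finite P" "card P = card E"
    "\<forall>t. \<exists>c. \<forall>x\<in>P. (\<Sum>m\<in>E. c m * g m x) = t x"
proof -
  have "j \<le> card E \<Longrightarrow> \<exists>P. P \<subseteq> X \<and> finite P \<and> card P = j \<and>
      (\<forall>t. \<exists>c. \<forall>x\<in>P. (\<Sum>m\<in>E. c m * g m x) = t x)" for j
  proof (induction j)
    case 0
    then show ?case by (intro exI[of _ "{}"]) simp
  next
    case (Suc j)
    then obtain P where P: "P \<subseteq> X" "finite P" "card P = j"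
      and onto: "\<And>t. \<exists>c. \<forall>x\<in>P. (\<Sum>m\<in>E. c m * g m x) = t x" by auto
    have "card P < card E" using P(3) Suc.prems by simp
    from linear_system_nontrivial_solution[OF P(2) assms(1) this, of g] obtain a
      where a: "\<exists>m\<in>E. a m \<noteq> 0" "\<forall>x\<in>P. (\<Sum>m\<in>E. a m * g m x) = 0" by blast
    have "\<exists>z\<in>X. (\<Sum>m\<in>E. a m * g m z) \<noteq> 0"
    proof (rule ccontr)
      assume "\<not> ?thesis"
      then have "\<forall>m\<in>E. a m = 0" by (intro indep) simp
      then show False using a(1) by simp
    qed
    then obtain z where z: "z \<in> X" "(\<Sum>m\<in>E. a m * g m z) \<noteq> 0" by blast
    let ?az = "\<Sum>m\<in>E. a m * g m z"
    have "z \<notin> P" using z(2) a(2) by blast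
    have "\<exists>c. \<forall>x\<in>insert z P. (\<Sum>m\<in>E. c m * g m x) = t x" for t
    proof -
      obtain c where c: "\<forall>x\<in>P. (\<Sum>m\<in>E. c m * g m x) = t x" using onto[of t] by blast
      define r where "r = (t z - (\<Sum>m\<in>E. c m * g m z)) / ?az"
      have eq: "(\<Sum>m\<in>E. (c m + r * a m) * g m x) = (\<Sum>m\<in>E. c m * g m x) + r * (\<Sum>m\<in>E. a m * g m x)" for x
        by (simp add: distrib_right sum.distrib sum_distrib_left mult.assoc)
      have "(\<Sum>m\<in>E. (c m + r * a m) * g m x) = t x" if "x \<in> insert z P" for x
        unfolding eq using that c a(2) z(2) by (auto simp: r_def)
      then show ?thesis by (intro exI[of _ "\<lambda>m. c m + r * a m"]) simp
    qed
    then show ?case using P z(1) \<open>z \<notin> P\<close> by (intro exI[of _ "insert z P"]) simp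
  qed
  from this[OF order_refl] show ?thesis by (elim exE conjE) (rule that, auto)
qed

text \<open>The unipotent map that adds \<open>N j v\<close> times the coordinate \<open>j \<in> C\<close> to the coordinate \<open>v \<notin> C\<close>.
  It carries the unit vectors of \<open>C\<close> to the chart vectors. The condition on \<open>j\<close>
  and \<open>v\<close> makes it preserve \<open>Aff k\<close>.\<close>

definition shear :: "nat \<Rightarrow> nat \<Rightarrow> nat set \<Rightarrow> (nat \<Rightarrow> nat \<Rightarrow> complex) \<Rightarrow> (nat \<Rightarrow> complex) \<Rightarrow> nat \<Rightarrow> complex" where
  "shear n k C N y = (\<lambda>v. y v + (if v \<le> n \<and> v \<notin> C then \<Sum>j | j \<in> C \<and> (j \<le> k \<longrightarrow> v \<le> k). y j * N j v else 0))"

text \<open>A shear changes only coordinates outside \<open>C\<close> and uses only those in \<open>C\<close>. So its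
  inverse is polynomial in \<open>N\<close>, which is what makes bad tuples polynomial in their parameters.\<close>

lemma shear_inverse: "shear n k C N (shear n k C (\<lambda>j v. - N j v) y) = y"
proof
  fix v
  have "(\<Sum>j | j \<in> C \<and> (j \<le> k \<longrightarrow> v \<le> k). shear n k C (\<lambda>j v. - N j v) y j * N j v) =
      (\<Sum>j | j \<in> C \<and> (j \<le> k \<longrightarrow> v \<le> k). y j * N j v)"
    by (rule sum.cong) (auto simp: shear_def)
  then show "shear n k C N (shear n k C (\<lambda>j v. - N j v) y) v = y v"
    by (subst shear_def, simp) (simp add: shear_def sum_negf)
qed

lemma shear_Aff: "y \<in> Aff n \<Longrightarrow> shear n k C N y \<in> Aff n"
  by (auto simp: shear_def Aff_def)

lemma shear_eq_lin:
  assumes "y \<in> Aff n" "C \<subseteq> {..n}"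
  shows "shear n k C N y = lin n (\<lambda>j. if j \<in> C then chart_vector n k C N j else unit j) y"
proof
  fix v
  have fin: "finite C" using assms(2) by (rule finite_subset) simp
  have "lin n (\<lambda>j. if j \<in> C then chart_vector n k C N j else unit j) y v =
     (\<Sum>j\<in>C \<union> ({..n} - C). y j * (if j \<in> C then chart_vector n k C N j else unit j) v)"
    using assms(2) by (simp add: lin_def Un_absorb1)
  also have "\<dots> = (\<Sum>j\<in>C. y j * chart_vector n k C N j v) + (\<Sum>j\<in>{..n} - C. y j * unit j v)"
    using fin by (subst sum.union_disjoint) auto
  also have "(\<Sum>j\<in>{..n} - C. y j * unit j v) = (if v \<in> C then 0 else y v)"
  proof -
    have "(\<Sum>j\<in>{..n} - C. y j * unit j v) = (\<Sum>j\<in>{..n} - C. if j = v then y v else 0)"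
      by (rule sum.cong) (auto simp: unit_def)
    also have "\<dots> = (if v \<in> C then 0 else y v)" using assms(1) by (auto simp: Aff_def not_le)
    finally show ?thesis .
  qed
  also have "(\<Sum>j\<in>C. y j * chart_vector n k C N j v) = (if v \<in> C then y v
      else if v \<le> n then \<Sum>j | j \<in> C \<and> (j \<le> k \<longrightarrow> v \<le> k). y j * N j v else 0)"
  proof (cases "v \<in> C")
    case True
    have "(\<Sum>j\<in>C. y j * chart_vector n k C N j v) = (\<Sum>j\<in>C. if j = v then y v else 0)"
      using True by (intro sum.cong) (auto simp: chart_vector_def)
    then show ?thesis using True fin by simp
  next
    case False
    have "(\<Sum>j\<in>C. y j * chart_vector n k C N j v) =
        (\<Sum>j\<in>C. if (j \<le> k \<longrightarrow> v \<le> k) then (if v \<le> n then y j * N j v else 0) else 0)"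
      using False by (intro sum.cong) (auto simp: chart_vector_def)
    then show ?thesis using False fin by (cases "v \<le> n") (simp_all add: sum.inter_filter cong: if_cong)
  qed
  finally show "shear n k C N y v = lin n (\<lambda>j. if j \<in> C then chart_vector n k C N j else unit j) y v"
    by (auto simp: shear_def)
qed

section \<open>Tuples vanishing on one or two planes\<close>

definition vanishes_on :: "nat \<Rightarrow> (nat \<Rightarrow> nat mpol) \<Rightarrow> (nat \<Rightarrow> complex) set \<Rightarrow> bool" where
  "vanishes_on s f W \<longleftrightarrow> (\<forall>i<s. \<forall>x\<in>W. mpol_eval (f i) x = 0)"

text \<open>In adapted coordinates the polynomials vanishing on \<open>W'\<close> are the combinations of these monomials.\<close>

definition monoms_off :: "nat \<Rightarrow> nat \<Rightarrow> nat \<Rightarrow> nat monom set" where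
  "monoms_off n k e = monoms {..n} e - monoms {..k} e"

lemma tuple_with_coefficients:
  "\<exists>f\<in>HomTuples n s d. \<forall>i<s. \<forall>x. mpol_eval (f i) x =
     (\<Sum>m\<in>monoms_off n k (d i). c i m * monom_eval m (lin n \<beta> x))"
proof -
  define p where "p i = (\<Sum>m\<in>monoms_off n k (d i). Poly_Mapping.single m (c i m))" for i
  have fin: "finite (monoms_off n k e)" for e by (simp add: monoms_off_def finite_monoms)
  have "Poly_Mapping.lookup (p i) m = (if m \<in> monoms_off n k (d i) then c i m else 0)" for i m
    by (simp add: p_def lookup_sum lookup_single when_def sum.delta fin)
  then have "Poly_Mapping.keys (p i) \<subseteq> monoms_off n k (d i)" for i
    by (auto simp: in_keys_iff split: if_splits)
  then have "p i \<in> Hom n (d i)" for i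
    unfolding Hom_def homogeneous_def monoms_off_def monoms_def by blast
  then have "\<forall>i. \<exists>h. h \<in> Hom n (d i) \<and> (\<forall>y. mpol_eval h y = mpol_eval (p i) (lin n \<beta> y))"
    using Hom_linear_substitution by blast
  from choice[OF this] obtain h where h: "\<And>i. h i \<in> Hom n (d i)"
    "\<And>i y. mpol_eval (h i) y = mpol_eval (p i) (lin n \<beta> y)" by blast
  show ?thesis
  proof (intro bexI[of _ "\<lambda>i. if i < s then h i else 0"] allI impI)
    fix i x assume "i < s"
    then show "mpol_eval (if i < s then h i else 0) x =
      (\<Sum>m\<in>monoms_off n k (d i). c i m * monom_eval m (lin n \<beta> x))"
      by (simp add: h(2) p_def mpol_eval_sum mpol_eval_single)
  next
    show "(\<lambda>i. if i < s then h i else 0) \<in> HomTuples n s d"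
      using h(1) by (simp add: HomTuples_def)
  qed
qed

text \<open>The number of points is the dimension of the space \<open>S\<close> of tuples vanishing on \<open>W' = lin n u ` Aff k\<close>, so the
  values at these points can serve as coordinates on \<open>S\<close>. Evaluations are used in place of
  the coefficients in adapted coordinates because they commute with linear substitutions.\<close>

lemma evaluation_points:
  assumes inv: "mutually_inverse n u \<beta>"
  obtains P where "P \<subseteq> {..<s} \<times> Aff n" "finite P"
    "card P = (\<Sum>i<s. card (monoms_off n k (d i)))"
    "\<forall>t. \<exists>f\<in>HomTuples n s d. vanishes_on s f (lin n u ` Aff k) \<and>
      (\<forall>(i, x)\<in>P. mpol_eval (f i) x = t (i, x))"
proof -
  let ?E = "SIGMA i:{..<s}. monoms_off n k (d i)"
  define g :: "nat \<times> nat monom \<Rightarrow> nat \<times> (nat \<Rightarrow> complex) \<Rightarrow> complex" where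
    "g = (\<lambda>(i, m) (i', x). if i' = i then monom_eval m (lin n \<beta> x) else 0)"
  have fin: "finite (monoms_off n k e)" for e by (simp add: monoms_off_def finite_monoms)
  have finE: "finite ?E" using fin by simp
  have sum: "(\<Sum>a\<in>?E. c a * g a (i, x)) = (\<Sum>m\<in>monoms_off n k (d i). c (i, m) * monom_eval m (lin n \<beta> x))"
    if "i < s" for c i x
  proof -
    have "(\<Sum>a\<in>?E. c a * g a (i, x)) =
        (\<Sum>j<s. \<Sum>m\<in>monoms_off n k (d j). c (j, m) * g (j, m) (i, x))"
      using fin by (subst sum.Sigma) (auto simp: case_prod_unfold)
    also have "\<dots> = (\<Sum>j<s. if j = i then \<Sum>m\<in>monoms_off n k (d i). c (i, m) * monom_eval m (lin n \<beta> x) else 0)"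
      by (rule sum.cong) (auto simp: g_def)
    finally show ?thesis using that by simp
  qed
  have indep: "\<forall>a\<in>?E. c a = 0" if z: "\<forall>a\<in>{..<s} \<times> Aff n. (\<Sum>m\<in>?E. c m * g m a) = 0" for c
  proof
    fix a assume "a \<in> ?E"
    then obtain i m where a: "a = (i, m)" and i: "i \<in> {..<s}" and m: "m \<in> monoms_off n k (d i)"
      by blast
    have "(\<Sum>l\<in>monoms_off n k (d i). c (i, l) * monom_eval l x) = 0" for x
    proof -
      define y where "y v = (if v \<le> n then x v else 0)" for v
      have yA: "y \<in> Aff n" by (simp add: y_def Aff_def)
      have "lin n u y \<in> Aff n" using inv by (intro lin_Aff) (simp add: mutually_inverse_def)
      then have "(\<Sum>l\<in>monoms_off n k (d i). c (i, l) * monom_eval l (lin n \<beta> (lin n u y))) = 0"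
        using bspec[OF z, of "(i, lin n u y)"] sum[of i c] i by simp
      also have "lin n \<beta> (lin n u y) = y" using inv yA by (simp add: mutually_inverse_def)
      also have "(\<Sum>l\<in>monoms_off n k (d i). c (i, l) * monom_eval l y) =
          (\<Sum>l\<in>monoms_off n k (d i). c (i, l) * monom_eval l x)"
      proof (rule sum.cong[OF refl])
        fix l assume "l \<in> monoms_off n k (d i)"
        then have "monom_eval l y = monom_eval l x"
          by (intro monom_eval_cong) (auto simp: y_def monoms_off_def monoms_def)
        then show "c (i, l) * monom_eval l y = c (i, l) * monom_eval l x" by simp
      qed
      finally show ?thesis .
    qed
    then show "c a = 0"
      unfolding a using monomials_linearly_independent[OF fin[of "d i"], of "\<lambda>l. c (i, l)" m] m by blast
  qed
  obtain P where P: "P \<subseteq> {..<s} \<times> Aff n" "finite P" "card P = card ?E"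
    and onto: "\<forall>t. \<exists>c. \<forall>a\<in>P. (\<Sum>m\<in>?E. c m * g m a) = t a"
    by (rule interpolation_points[where X = "{..<s} \<times> Aff n" and g = g, OF finE])
      (erule indep, erule (3) that)
  have card: "card ?E = (\<Sum>i<s. card (monoms_off n k (d i)))" using fin by simp
  have "\<exists>f\<in>HomTuples n s d. vanishes_on s f (lin n u ` Aff k) \<and> (\<forall>(i, x)\<in>P. mpol_eval (f i) x = t (i, x))" for t
  proof -
    obtain c where c: "\<forall>a\<in>P. (\<Sum>m\<in>?E. c m * g m a) = t a" using onto[THEN spec, of t] by (rule exE)
    obtain f where f1: "f \<in> HomTuples n s d" and "\<forall>i<s. \<forall>x. mpol_eval (f i) x =
      (\<Sum>m\<in>monoms_off n k (d i). c (i, m) * monom_eval m (lin n \<beta> x))"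
      using tuple_with_coefficients[where c = "\<lambda>i m. c (i, m)" and \<beta> = \<beta>] by (rule bexE)
    then have f2: "mpol_eval (f i) x =
      (\<Sum>m\<in>monoms_off n k (d i). c (i, m) * monom_eval m (lin n \<beta> x))" if "i < s" for i x
      using that by simp
    have "mpol_eval (f i) (lin n u y) = 0" if "i < s" "y \<in> Aff k" for i y
    proof (cases "k \<le> n")
      case True
      then have "y \<in> Aff n" using that(2) by (auto simp: Aff_def)
      then have "lin n \<beta> (lin n u y) = y" using inv by (simp add: mutually_inverse_def)
      moreover have "monom_eval m y = 0" if "m \<in> monoms_off n k (d i)" for m
        using that \<open>y \<in> Aff k\<close>
        by (intro monom_eval_off_support[of m "{..k}"]) (auto simp: monoms_off_def monoms_def Aff_def)
      ultimately show ?thesis using f2[OF that(1)] by simp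
    next
      case False
      then have "{..n} \<subseteq> {..k}" by auto
      then have "monoms_off n k (d i) = {}" using monoms_mono[of "{..n}" "{..k}" "d i"] by (simp add: monoms_off_def)
      then show ?thesis using f2[OF that(1)] by simp
    qed
    then have "vanishes_on s f (lin n u ` Aff k)" by (auto simp: vanishes_on_def)
    moreover have "mpol_eval (f i) x = t (i, x)" if "(i, x) \<in> P" for i x
    proof -
      have "i < s" using that P(1) by auto
      then show ?thesis using bspec[OF c that] by (simp add: f2 sum)
    qed
    ultimately show ?thesis using f1 by blast
  qed
  with P card show ?thesis by (intro that[of P]) simp_all
qed

text \<open>A row with pivot in \<open>{..k}\<close> has a free entry in each non-pivot column up to \<open>k\<close>; every other row
  has one in each of the \<open>n - k\<close> non-pivot columns.\<close>

lemma chart_parameter_count: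
  assumes "C \<subseteq> {..n}" "card C = k + 1" "k \<le> n"
  defines "a \<equiv> card (C \<inter> {..k})"
  shows "card {(j, v). j \<in> C \<and> v \<le> n \<and> v \<notin> C \<and> (j \<le> k \<longrightarrow> v \<le> k)} = (k + 1 - a) * (a + (n - k))"
proof -
  have fin: "finite C" using assms(1) by (rule finite_subset) simp
  have "{(j, v). j \<in> C \<and> v \<le> n \<and> v \<notin> C \<and> (j \<le> k \<longrightarrow> v \<le> k)} =
      (C \<inter> {..k}) \<times> ({..k} - C) \<union> (C - {..k}) \<times> ({..n} - C)"
    using assms(3) by auto
  also have "card \<dots> = card ((C \<inter> {..k}) \<times> ({..k} - C)) + card ((C - {..k}) \<times> ({..n} - C))"
    using fin by (intro card_Un_disjoint) auto
  also have "\<dots> = a * (k + 1 - a) + (k + 1 - a) * (n - k)"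
  proof -
    have "card ({..k} - C) = k + 1 - a"
      using card_Diff_subset_Int[of "{..k}" C] by (simp add: a_def Int_commute)
    moreover have "card (C - {..k}) = k + 1 - a"
      using card_Diff_subset_Int[of C "{..k}"] assms(2) by (simp add: a_def)
    moreover have "card ({..n} - C) = n - k"
      using card_Diff_subset[OF fin assms(1)] assms(2) by simp
    ultimately show ?thesis by (simp add: card_cartesian_product a_def)
  qed
  finally show ?thesis by (simp add: algebra_simps)
qed

text \<open>Of the monomials off \<open>{..k}\<close>, those supported in \<open>C\<close> are lost in a chart. They are all the
  monomials in \<open>C\<close> except those in the \<open>a\<close> variables of \<open>C \<inter> {..k}\<close>. The equation is
  written without subtraction.\<close>

lemma card_monoms_off_chart:
  assumes "C \<subseteq> {..n}" "card C = k + 1" "k \<le> n"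
  defines "a \<equiv> card (C \<inter> {..k})"
  shows "card (monoms_off n k e) + ((a + e - 1) choose e) =
     card (monoms_off n k e - monoms C e) + ((k + 1 + e - 1) choose e)"
proof -
  have fin: "finite C" using assms(1) by (rule finite_subset) simp
  have int: "monoms_off n k e \<inter> monoms C e = monoms C e - monoms (C \<inter> {..k}) e"
    using assms(1) by (auto simp: monoms_off_def monoms_def)
  have "card (monoms C e) = card (monoms C e - monoms (C \<inter> {..k}) e) + card (monoms (C \<inter> {..k}) e)"
    using fin card_Diff_subset[of "monoms (C \<inter> {..k}) e" "monoms C e"] card_mono[of "monoms C e" "monoms (C \<inter> {..k}) e"]
    by (simp add: finite_monoms monoms_mono)
  then have "(k + 1 + e - 1) choose e = card (monoms_off n k e \<inter> monoms C e) + ((a + e - 1) choose e)"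
    using fin assms(2) by (simp add: int card_monoms a_def)
  moreover have "card (monoms_off n k e) = card (monoms_off n k e - monoms C e) + card (monoms_off n k e \<inter> monoms C e)"
    using card_Int_Diff[of "monoms_off n k e" "monoms C e"] by (simp add: monoms_off_def finite_monoms)
  ultimately show ?thesis by simp
qed

text \<open>In adapted coordinates the shear preserves \<open>Aff k\<close> and carries the coordinate subspace of \<open>C\<close> into
  \<open>W\<close>. So \<open>f\<close>, composed with it, vanishes on both coordinate subspaces and contains only
  monomials supported in neither; \<open>f\<close> is recovered by the inverse shear.\<close>

lemma evaluations_in_chart:
  assumes inv: "mutually_inverse n u \<beta>" and C: "C \<subseteq> {..n}" and kn: "k \<le> n"
    and f: "f \<in> Hom n e" "\<And>y. y \<in> Aff k \<Longrightarrow> mpol_eval f (lin n u y) = 0"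
    and W: "vs.subspace W" "\<And>j. j \<in> C \<Longrightarrow> lin n u (chart_vector n k C N j) \<in> W"
       "\<And>x. x \<in> W \<Longrightarrow> mpol_eval f x = 0"
  shows "\<exists>c. \<forall>x\<in>Aff n. mpol_eval f x =
    (\<Sum>m\<in>monoms_off n k e - monoms C e. c m * monom_eval m (shear n k C (\<lambda>j v. - N j v) (lin n \<beta> x)))"
proof -
  define \<tau> where "\<tau> = (\<lambda>j. if j \<in> C then chart_vector n k C N j else unit j)"
  obtain h where h: "h \<in> Hom n e" "\<And>y. mpol_eval h y = mpol_eval f (lin n (\<lambda>j. lin n u (\<tau> j)) y)"
    using Hom_linear_substitution[OF f(1)] by blast
  have he: "mpol_eval h y = mpol_eval f (lin n u (shear n k C N y))" if "y \<in> Aff n" for y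
    using h(2)[of y] shear_eq_lin[OF that C, of k N] lin_lin[of n u n \<tau> y] by (simp only: \<tau>_def)
  have onC: "mpol_eval h y = 0" if y: "\<And>v. v \<notin> C \<Longrightarrow> y v = 0" for y
  proof -
    have "lin n (\<lambda>j. lin n u (\<tau> j)) y = lin n (\<lambda>j. if j \<in> C then lin n u (chart_vector n k C N j) else 0) y"
      unfolding lin_def fun_eq_iff
    proof (intro allI sum.cong refl)
      fix v j
      show "y j * (\<Sum>i\<le>n. \<tau> j i * u i v) =
          y j * (if j \<in> C then \<lambda>v. \<Sum>i\<le>n. chart_vector n k C N j i * u i v else 0) v"
        using y by (cases "j \<in> C") (auto simp: \<tau>_def)
    qed
    also have "\<dots> \<in> W"
      using W(2) vs.subspace_0[OF W(1)] by (intro lin_in_subspace[OF W(1)]) auto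
    finally show ?thesis using h(2) W(3) by simp
  qed
  have onk: "mpol_eval h y = 0" if y: "\<And>v. v \<notin> {..k} \<Longrightarrow> y v = 0" for y
  proof -
    have yA: "y \<in> Aff n" using y kn by (auto simp: Aff_def)
    have "shear n k C N y \<in> Aff k"
      using y by (auto simp: Aff_def shear_def intro!: sum.neutral)
    then show ?thesis using he[OF yA] f(2) by simp
  qed
  have "m \<in> monoms_off n k e - monoms C e" if "m \<in> Poly_Mapping.keys h" for m
  proof -
    have "m \<in> monoms {..n} e" using keys_Hom[OF h(1)] that by blast
    moreover have "\<not> Poly_Mapping.keys m \<subseteq> C" "\<not> Poly_Mapping.keys m \<subseteq> {..k}"
      using vanishing_on_coordinate_subspace[of C h m, OF onC that]
        vanishing_on_coordinate_subspace[of "{..k}" h m, OF onk that] by blast+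
    ultimately show ?thesis by (auto simp: monoms_off_def monoms_def)
  qed
  then have keys: "Poly_Mapping.keys h \<subseteq> monoms_off n k e - monoms C e" by blast
  have "mpol_eval f x = (\<Sum>m\<in>monoms_off n k e - monoms C e. Poly_Mapping.lookup h m *
      monom_eval m (shear n k C (\<lambda>j v. - N j v) (lin n \<beta> x)))" if x: "x \<in> Aff n" for x
  proof -
    let ?y = "shear n k C (\<lambda>j v. - N j v) (lin n \<beta> x)"
    have "lin n \<beta> x \<in> Aff n" using inv by (intro lin_Aff) (simp add: mutually_inverse_def)
    then have "?y \<in> Aff n" by (rule shear_Aff)
    from he[OF this] have "mpol_eval f x = mpol_eval h ?y"
      using inv x by (simp add: shear_inverse mutually_inverse_def)
    also have "\<dots> = (\<Sum>m\<in>monoms_off n k e - monoms C e. Poly_Mapping.lookup h m * monom_eval m ?y)"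
      using keys by (intro mpol_eval_superset) (simp_all add: monoms_off_def finite_monoms)
    finally show ?thesis .
  qed
  then show ?thesis by blast
qed

section \<open>An equation for the bad tuples of one chart\<close>

text \<open>The value at \<open>x\<close> of the \<open>i\<close>-th polynomial of a tuple, as a linear form in the coefficients of the
  tuple.\<close>

definition evaluation_form :: "nat \<Rightarrow> (nat \<Rightarrow> nat) \<Rightarrow> nat \<times> (nat \<Rightarrow> complex) \<Rightarrow> (nat \<times> nat monom) mpol" where
  "evaluation_form n d = (\<lambda>(i, x). \<Sum>m\<in>monoms {..n} (d i). Poly_Mapping.single 0 (monom_eval m x) * var (i, m))"

lemma homogeneous_evaluation_form: "homogeneous 1 (evaluation_form n d a)"
  using homogeneous_mult[OF homogeneous_const homogeneous_var]
  by (auto simp: evaluation_form_def case_prod_unfold intro!: homogeneous_sum)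

lemma mpol_eval_evaluation_form:
  assumes "f \<in> HomTuples n s d" "i < s"
  shows "mpol_eval (evaluation_form n d (i, x)) (coeffs_of f) = mpol_eval (f i) x"
proof -
  have "Poly_Mapping.keys (f i) \<subseteq> monoms {..n} (d i)"
    using assms by (intro keys_Hom) (auto simp: HomTuples_def)
  then have "mpol_eval (f i) x = (\<Sum>m\<in>monoms {..n} (d i). Poly_Mapping.lookup (f i) m * monom_eval m x)"
    by (intro mpol_eval_superset) (simp_all add: finite_monoms)
  then show ?thesis
    by (simp add: evaluation_form_def mpol_eval_sum mpol_eval_mult mpol_eval_const coeffs_of_def mult.commute)
qed

text \<open>The parameters of the bad tuples in the chart \<open>C\<close> are the free entries of \<open>- N\<close> (tagged \<open>Inl\<close>)
  and the coefficients of the monomials left in the chart (tagged \<open>Inr\<close>). A chart with \<open>C\<close> not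
  contained in \<open>{..k}\<close> has \<open>a = card (C \<inter> {..k}) \<le> k\<close>, where the dimension inequality holds, so
  there are fewer parameters than evaluation points. The relation between the evaluations is
  pulled back to the coefficients of tuples by the evaluation forms; as these
  take arbitrary values on \<open>S\<close> at the chosen points, the pullback is not zero on \<open>S\<close>.\<close>

lemma chart_obstruction:
  fixes d :: "nat \<Rightarrow> nat"
  assumes inv: "mutually_inverse n u \<beta>" and kn: "k \<le> n"
    and C: "C \<subseteq> {..n}" "card C = k + 1" "\<not> C \<subseteq> {..k}"
    and ds: "s \<ge> 1" "\<forall>i<s. d i \<ge> 2" "\<not> (s = 1 \<and> d 0 = 2)"
    and neg: "(k + 1) * (n - k) < (\<Sum>i<s. (k + 1 + d i - 1) choose d i)"
  shows "\<exists>p. (\<exists>e. homogeneous e p) \<and>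
    (\<exists>f\<in>HomTuples n s d. vanishes_on s f (lin n u ` Aff k) \<and> mpol_eval p (coeffs_of f) \<noteq> 0) \<and>
    (\<forall>f\<in>HomTuples n s d. \<forall>N W. vanishes_on s f (lin n u ` Aff k) \<longrightarrow> vs.subspace W \<longrightarrow>
      (\<forall>j\<in>C. lin n u (chart_vector n k C N j) \<in> W) \<longrightarrow> vanishes_on s f W \<longrightarrow>
      mpol_eval p (coeffs_of f) = 0)"
proof -
  define T where "T = {(j, v). j \<in> C \<and> v \<le> n \<and> v \<notin> C \<and> (j \<le> k \<longrightarrow> v \<le> k)}"
  define M where "M i = monoms_off n k (d i) - monoms C (d i)" for i
  define X :: "(nat \<times> nat + nat \<times> nat monom) set" where
    "X = Inl ` T \<union> Inr ` (SIGMA i:{..<s}. M i)"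
  define \<sigma> :: "(nat \<Rightarrow> complex) \<Rightarrow> nat \<Rightarrow> (nat \<times> nat + nat \<times> nat monom) mpol" where
    "\<sigma> q v = Poly_Mapping.single 0 (q v) + (if v \<le> n \<and> v \<notin> C
       then \<Sum>j | j \<in> C \<and> (j \<le> k \<longrightarrow> v \<le> k). Poly_Mapping.single 0 (q j) * var (Inl (j, v)) else 0)" for q v
  \<comment> \<open>the values of a bad tuple as polynomials in its parameters; \<open>Inl\<close> stands for the entries of \<open>- N\<close>\<close>
  define \<phi> where "\<phi> = (\<lambda>(i, x). \<Sum>m\<in>M i. var (Inr (i, m)) * msubst (\<sigma> (lin n \<beta> x)) (Poly_Mapping.single m 1))"
  have finC: "finite C" using C(1) by (rule finite_subset) simp
  have finT: "finite T"
    by (rule finite_subset[of _ "{..n} \<times> {..n}"]) (use C(1) in \<open>auto simp: T_def\<close>)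
  have finM: "finite (M i)" for i by (simp add: M_def monoms_off_def finite_monoms)
  have finX: "finite X" using finT finM by (simp add: X_def)
  have \<sigma>X: "\<sigma> q v \<in> mpols_in X" for q v
    unfolding \<sigma>_def
    by (auto intro!: mpols_in_add mpols_in_const mpols_in_sum mpols_in_mult mpols_in_var mpols_in_zero
        simp: X_def T_def)
  have \<phi>X: "\<phi> a \<in> mpols_in X" if "fst a < s" for a
  proof -
    obtain i x where a: "a = (i, x)" by (cases a)
    have "var (Inr (i, m)) * msubst (\<sigma> (lin n \<beta> x)) (Poly_Mapping.single m 1) \<in> mpols_in X" if "m \<in> M i" for m
      using that \<open>fst a < s\<close> a
      by (intro mpols_in_mult mpols_in_var mpols_in_msubst[of _ UNIV] \<sigma>X)
        (auto simp: X_def mpols_in_def)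
    then show ?thesis unfolding \<phi>_def a prod.case by (intro mpols_in_sum)
  qed
  have eval_\<phi>: "mpol_eval (\<phi> (i, x)) z = (\<Sum>m\<in>M i. z (Inr (i, m)) *
      monom_eval m (shear n k C (\<lambda>j v. z (Inl (j, v))) (lin n \<beta> x)))" for i x z
  proof -
    have "(\<lambda>v. mpol_eval (\<sigma> q v) z) = shear n k C (\<lambda>j v. z (Inl (j, v))) q" for q
      by (auto simp: \<sigma>_def shear_def fun_eq_iff mpol_eval_add mpol_eval_const mpol_eval_sum mpol_eval_mult)
    then show ?thesis
      by (simp add: \<phi>_def mpol_eval_sum mpol_eval_mult mpol_eval_msubst mpol_eval_single)
  qed
  obtain P where P: "P \<subseteq> {..<s} \<times> Aff n" "finite P" "card P = (\<Sum>i<s. card (monoms_off n k (d i)))"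
    and onto: "\<forall>t. \<exists>f\<in>HomTuples n s d. vanishes_on s f (lin n u ` Aff k) \<and>
      (\<forall>(i, x)\<in>P. mpol_eval (f i) x = t (i, x))"
    using inv by (rule evaluation_points)
  have "card X < card P"
  proof -
    define a where "a = card (C \<inter> {..k})"
    have "C \<inter> {..k} \<subset> C" using C(3) by blast
    then have "a < k + 1" using psubset_card_mono[OF finC] C(2) by (simp add: a_def)
    then have ineq: "(k + 1 - a) * (a + (n - k)) + (\<Sum>i<s. (a + d i - 1) choose d i)
        < (\<Sum>i<s. (k + 1 + d i - 1) choose d i)"
      by (rule dimension_inequality[OF ds neg])
    have "(\<Sum>i<s. card (monoms_off n k (d i)) + ((a + d i - 1) choose d i)) =
        (\<Sum>i<s. card (M i) + ((k + 1 + d i - 1) choose d i))"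
      unfolding M_def a_def by (intro sum.cong refl card_monoms_off_chart C kn)
    then have dims: "card P + (\<Sum>i<s. (a + d i - 1) choose d i) =
        (\<Sum>i<s. card (M i)) + (\<Sum>i<s. (k + 1 + d i - 1) choose d i)"
      by (simp only: sum.distrib P(3))
    have "card X = card T + (\<Sum>i<s. card (M i))"
      unfolding X_def using finT finM by (subst card_Un_disjoint) (auto simp: card_image)
    also have "card T = (k + 1 - a) * (a + (n - k))"
      unfolding T_def a_def by (rule chart_parameter_count[OF C(1,2) kn])
    finally show ?thesis using ineq dims by linarith
  qed
  moreover have "\<phi> a \<in> mpols_in X" if "a \<in> P" for a using \<phi>X[of a] that P(1) by auto
  ultimately have "\<exists>Q. Q \<noteq> 0 \<and> Q \<in> mpols_in P \<and> (\<forall>z. mpol_eval Q (\<lambda>a. mpol_eval (\<phi> a) z) = 0)"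
    by (rule algebraic_dependence[OF finX P(2)])
  then obtain Q where "Q \<noteq> 0 \<and> Q \<in> mpols_in P \<and> (\<forall>z. mpol_eval Q (\<lambda>a. mpol_eval (\<phi> a) z) = 0)"
    by (rule exE)
  then have Q: "Q \<noteq> 0" "Q \<in> mpols_in P" "\<And>z. mpol_eval Q (\<lambda>a. mpol_eval (\<phi> a) z) = 0"
    by simp_all
  obtain e where e: "hom_part e Q \<noteq> 0" using nonzero_hom_part[OF Q(1)] by blast
  have QeP: "hom_part e Q \<in> mpols_in P"
    using Q(2) by (auto simp: mpols_in_def in_keys_iff lookup_hom_part split: if_splits)
  define p where "p = msubst (evaluation_form n d) (hom_part e Q)"
  have p_eval: "mpol_eval p (coeffs_of f) = mpol_eval (hom_part e Q) (\<lambda>(i, x). mpol_eval (f i) x)"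
    if f: "f \<in> HomTuples n s d" for f
    unfolding p_def mpol_eval_msubst
  proof (rule mpol_eval_cong[OF QeP])
    fix a assume "a \<in> P"
    then obtain i x where "a = (i, x)" "i < s" using P(1) by blast
    then show "mpol_eval (evaluation_form n d a) (coeffs_of f) = (\<lambda>(i, x). mpol_eval (f i) x) a"
      using mpol_eval_evaluation_form[OF f] by simp
  qed
  have "homogeneous e p"
    unfolding p_def by (intro homogeneous_msubst homogeneous_hom_part homogeneous_evaluation_form)
  moreover have "\<exists>f\<in>HomTuples n s d. vanishes_on s f (lin n u ` Aff k) \<and> mpol_eval p (coeffs_of f) \<noteq> 0"
  proof -
    obtain t where t: "mpol_eval (hom_part e Q) t \<noteq> 0" using mpol_eq_zeroI e by blast
    obtain f where f: "f \<in> HomTuples n s d"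
      and f': "vanishes_on s f (lin n u ` Aff k) \<and> (\<forall>(i, x)\<in>P. mpol_eval (f i) x = t (i, x))"
      using onto[THEN spec, of t] by (rule bexE)
    have "mpol_eval p (coeffs_of f) = mpol_eval (hom_part e Q) t"
      unfolding p_eval[OF f] by (rule mpol_eval_cong[OF QeP]) (use f' in auto)
    then show ?thesis using f f' t by (intro bexI[of _ f]) simp_all
  qed
  moreover have "mpol_eval p (coeffs_of f) = 0"
    if f: "f \<in> HomTuples n s d" "vanishes_on s f (lin n u ` Aff k)" and W: "vs.subspace W"
      "\<forall>j\<in>C. lin n u (chart_vector n k C N j) \<in> W" "vanishes_on s f W" for f N W
  proof -
    have "\<forall>i. \<exists>c. i < s \<longrightarrow> (\<forall>x\<in>Aff n. mpol_eval (f i) x = (\<Sum>m\<in>M i. c m *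
        monom_eval m (shear n k C (\<lambda>j v. - N j v) (lin n \<beta> x))))"
    proof
      fix i
      show "\<exists>c. i < s \<longrightarrow> (\<forall>x\<in>Aff n. mpol_eval (f i) x = (\<Sum>m\<in>M i. c m *
        monom_eval m (shear n k C (\<lambda>j v. - N j v) (lin n \<beta> x))))"
      proof (cases "i < s")
        case True
        then have "f i \<in> Hom n (d i)" using f(1) by (simp add: HomTuples_def)
        moreover have "mpol_eval (f i) (lin n u y) = 0" if "y \<in> Aff k" for y
          using that f(2) True by (simp add: vanishes_on_def)
        moreover have "mpol_eval (f i) x = 0" if "x \<in> W" for x
          using that W(3) True by (simp add: vanishes_on_def)
        ultimately have "\<exists>c. \<forall>x\<in>Aff n. mpol_eval (f i) x = (\<Sum>m\<in>M i. c m *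
          monom_eval m (shear n k C (\<lambda>j v. - N j v) (lin n \<beta> x)))"
          unfolding M_def using W(1,2) by (intro evaluations_in_chart[OF inv C(1) kn, where W = W]) simp_all
        then show ?thesis by simp
      qed simp
    qed
    from choice[OF this] obtain c where c: "\<forall>i. i < s \<longrightarrow> (\<forall>x\<in>Aff n. mpol_eval (f i) x =
      (\<Sum>m\<in>M i. c i m * monom_eval m (shear n k C (\<lambda>j v. - N j v) (lin n \<beta> x))))" by (rule exE)
    \<comment> \<open>scaling a bad tuple by \<open>t\<close> scales its \<open>Inr\<close> parameters, so \<open>Q\<close> vanishes on a cone\<close>
    have "mpol_eval Q (\<lambda>a. t * (\<lambda>(i, x). mpol_eval (f i) x) a) = 0" for t
    proof -
      define z where "z = case_sum (\<lambda>(j, v). - N j v) (\<lambda>(i, m). t * c i m)"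
      have "mpol_eval Q (\<lambda>a. t * (\<lambda>(i, x). mpol_eval (f i) x) a) = mpol_eval Q (\<lambda>a. mpol_eval (\<phi> a) z)"
      proof (rule mpol_eval_cong[OF Q(2)])
        fix a assume "a \<in> P"
        then obtain i x where a: "a = (i, x)" "i < s" "x \<in> Aff n" using P(1) by blast
        then have "mpol_eval (f i) x = (\<Sum>m\<in>M i. c i m *
            monom_eval m (shear n k C (\<lambda>j v. - N j v) (lin n \<beta> x)))"
          using c by blast
        then show "t * (\<lambda>(i, x). mpol_eval (f i) x) a = mpol_eval (\<phi> a) z"
          unfolding a(1) eval_\<phi> by (simp add: z_def sum_distrib_left mult.assoc)
      qed
      then show ?thesis using Q(3) by simp
    qed
    then show ?thesis unfolding p_eval[OF f(1)] by (rule hom_part_vanishes_on_cone)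
  qed
  ultimately show ?thesis by (intro exI[of _ p]) blast
qed

section \<open>Genericity\<close>

lemma lookup_scalar_mult: "Poly_Mapping.lookup (Poly_Mapping.single 0 c * p) m = c * Poly_Mapping.lookup (p :: 'v mpol) m"
  unfolding mult_map_scale_conv_mult[symmetric] by (simp add: Poly_Mapping.map.rep_eq when_def)

lemma tscale_eq: "tscale c f = (\<lambda>i. Poly_Mapping.single 0 c * f i)"
  by (simp add: tscale_def mult_map_scale_conv_mult)

lemma coeffs_of_tscale: "coeffs_of (tscale c f) = (\<lambda>a. c * coeffs_of f a)"
  by (auto simp: coeffs_of_def tscale_eq lookup_scalar_mult)

lemma tscale_one [simp]: "tscale 1 f = f"
  by (simp add: tscale_eq)

lemma Hom_linear_combination:
  assumes "p \<in> Hom n e" "q \<in> Hom n e"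
  shows "Poly_Mapping.single 0 a * p + Poly_Mapping.single 0 b * q \<in> Hom n e"
proof -
  have "Poly_Mapping.keys (Poly_Mapping.single 0 a * p + Poly_Mapping.single 0 b * q)
      \<subseteq> Poly_Mapping.keys p \<union> Poly_Mapping.keys q"
    by (auto simp: in_keys_iff lookup_add lookup_scalar_mult)
  then show ?thesis using assms unfolding Hom_def homogeneous_def by blast
qed

lemma HomTuples_linear_combination:
  assumes "f \<in> HomTuples n s d" "g \<in> HomTuples n s d"
  shows "(\<lambda>i. Poly_Mapping.single 0 a * f i + Poly_Mapping.single 0 b * g i) \<in> HomTuples n s d"
  using assms Hom_linear_combination by (simp add: HomTuples_def)

text \<open>The lines are formed in the space of coefficients, where \<open>common_nonzero_on_line\<close> applies.\<close>

definition contains_lines :: "(nat \<Rightarrow> nat mpol) set \<Rightarrow> bool" where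
  "contains_lines S \<longleftrightarrow> (\<forall>f\<in>S. \<forall>g\<in>S. \<forall>t. \<exists>h\<in>S. coeffs_of h = (\<lambda>a. coeffs_of f a + t * (coeffs_of g a - coeffs_of f a)))"

lemma common_nonzero_in_contains_lines:
  assumes "contains_lines S" "f \<in> S" "g \<in> S" "mpol_eval p (coeffs_of f) \<noteq> 0" "mpol_eval q (coeffs_of g) \<noteq> 0"
  shows "\<exists>h\<in>S. mpol_eval (p * q) (coeffs_of h) \<noteq> 0"
proof -
  obtain t where t: "mpol_eval p (\<lambda>a. coeffs_of f a + t * (coeffs_of g a - coeffs_of f a)) \<noteq> 0"
    "mpol_eval q (\<lambda>a. coeffs_of f a + t * (coeffs_of g a - coeffs_of f a)) \<noteq> 0"
    using common_nonzero_on_line[OF assms(4,5)] by blast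
  obtain h where "h \<in> S" "coeffs_of h = (\<lambda>a. coeffs_of f a + t * (coeffs_of g a - coeffs_of f a))"
    using assms(1-3) unfolding contains_lines_def by blast
  then show ?thesis using t by (intro bexI[of _ h]) (simp_all add: mpol_eval_mult)
qed

lemma nonzero_of_product:
  assumes "contains_lines S" "S \<noteq> {}" "finite I" "\<And>i. i \<in> I \<Longrightarrow> \<exists>f\<in>S. mpol_eval (p i) (coeffs_of f) \<noteq> 0"
  shows "\<exists>f\<in>S. mpol_eval (\<Prod>i\<in>I. p i) (coeffs_of f) \<noteq> 0"
  using assms(3,4)
proof (induction I rule: finite_induct)
  case empty
  then show ?case using assms(2) by auto
next
  case (insert i I)
  obtain f where f: "f \<in> S" "mpol_eval (p i) (coeffs_of f) \<noteq> 0" using insert.prems by blast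
  obtain g where g: "g \<in> S" "mpol_eval (\<Prod>i\<in>I. p i) (coeffs_of g) \<noteq> 0" using insert by blast
  show ?case
    using common_nonzero_in_contains_lines[OF assms(1) f(1) g(1) f(2) g(2)] insert.hyps by simp
qed

text \<open>An open set is a union of nonzero loci, so density says that a polynomial \<open>q\<close> that is nonzero
  somewhere on \<open>S\<close> has a common nonzero point with \<open>p\<close>.\<close>

lemma dense_open_nonzero_locus:
  assumes S: "contains_lines S" and p: "homogeneous e p" and f: "f \<in> S" "mpol_eval p (coeffs_of f) \<noteq> 0"
  shows "dense_open (zariski (proj tscale S) ((`) coeffs_of)) (nonzero_locus (proj tscale S) ((`) coeffs_of) p)"
proof -
  let ?X = "proj tscale S"
  have locus: "proj_class tscale h \<in> nonzero_locus ?X ((`) coeffs_of) q"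
    if "h \<in> S" "h \<noteq> 0" "homogeneous e q" "mpol_eval q (coeffs_of h) \<noteq> 0" for h q e
    using that by (auto simp: nonzero_locus_def proj_def proj_class_def coeffs_of_tscale mpol_eval_scale)
  have "openin (zariski ?X ((`) coeffs_of)) (nonzero_locus ?X ((`) coeffs_of) p)"
    unfolding openin_zariski using p by (intro exI[of _ "{p}"]) auto
  moreover have "nonzero_locus ?X ((`) coeffs_of) p \<inter> T \<noteq> {}"
    if T: "openin (zariski ?X ((`) coeffs_of)) T" "T \<noteq> {}" for T
  proof -
    obtain R where R: "\<forall>q\<in>R. \<exists>e. homogeneous e q" "T = (\<Union>q\<in>R. nonzero_locus ?X ((`) coeffs_of) q)"
      using T(1) unfolding openin_zariski by blast
    then obtain q L where q: "q \<in> R" "L \<in> nonzero_locus ?X ((`) coeffs_of) q" using T(2) by blast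
    then obtain e' where e': "homogeneous e' q" using R(1) by blast
    obtain g where g: "g \<in> S" "g \<noteq> 0" "L = proj_class tscale g"
      using q(2) by (auto simp: nonzero_locus_def proj_def)
    have "g \<in> L" using g(3) tscale_one[of g] unfolding proj_class_def by (auto intro!: exI[of _ 1])
    then have qg: "mpol_eval q (coeffs_of g) \<noteq> 0" using q(2) by (simp add: nonzero_locus_def)
    obtain i m where im: "Poly_Mapping.lookup (g i) m \<noteq> 0"
      using g(2) by (auto simp: fun_eq_iff poly_mapping_eq_iff)
    \<comment> \<open>the extra coordinate keeps the common point away from the zero tuple, which has no class in \<open>?X\<close>\<close>
    have "mpol_eval (q * var (i, m)) (coeffs_of g) \<noteq> 0"
      using qg im by (simp add: mpol_eval_mult coeffs_of_def)
    from common_nonzero_in_contains_lines[OF S f(1) g(1) f(2) this]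
    obtain h where h: "h \<in> S" "mpol_eval (p * (q * var (i, m))) (coeffs_of h) \<noteq> 0" by blast
    have "h \<noteq> 0"
    proof
      assume "h = 0"
      then have "coeffs_of h (i, m) = 0" by (simp add: coeffs_of_def)
      then show False using h(2) by (simp add: mpol_eval_mult)
    qed
    then have "proj_class tscale h \<in> nonzero_locus ?X ((`) coeffs_of) p"
      "proj_class tscale h \<in> nonzero_locus ?X ((`) coeffs_of) q"
      using locus[OF h(1) _ p] locus[OF h(1) _ e'] h(2) by (auto simp: mpol_eval_mult)
    then show ?thesis unfolding R(2) using q(1) by blast
  qed
  ultimately show ?thesis unfolding dense_open_def dense_intersects_open by blast
qed

text \<open>A plane consists of classes of nonzero vectors; at the zero vector the polynomials vanish because
  their degrees are positive.\<close>

lemma plane_in_zero_variety_iff: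
  assumes "vs.subspace W" "W \<subseteq> Aff n" "f \<in> HomTuples n s d" "\<forall>i<s. d i \<ge> 2"
  shows "proj vscale W \<subseteq> zero_variety n s f \<longleftrightarrow> vanishes_on s f W"
proof
  assume sub: "proj vscale W \<subseteq> zero_variety n s f"
  show "vanishes_on s f W"
    unfolding vanishes_on_def
  proof (intro allI impI ballI)
    fix i x assume i: "i < s" and x: "x \<in> W"
    show "mpol_eval (f i) x = 0"
    proof (cases "x = 0")
      case True
      have "homogeneous (d i) (f i)" using assms(3) i by (simp add: HomTuples_def Hom_def)
      moreover have "d i \<noteq> 0" using assms(4) i by fastforce
      ultimately have "mpol_eval (f i) (\<lambda>v. 0) = 0"
        using mpol_eval_scale[of "d i" "f i" 0 x] by (simp add: power_0_left)
      then show ?thesis using True by (simp add: zero_fun_def)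
    next
      case False
      then have "proj_class vscale x \<in> zero_variety n s f"
        using sub x by (auto simp: proj_def)
      moreover have "x \<in> proj_class vscale x"
        unfolding proj_class_def by (auto simp: vscale_def intro!: exI[of _ 1])
      ultimately show ?thesis using i by (auto simp: zero_variety_def)
    qed
  qed
next
  assume van: "vanishes_on s f W"
  show "proj vscale W \<subseteq> zero_variety n s f"
  proof
    fix L assume "L \<in> proj vscale W"
    then obtain x where x: "x \<in> W" "x \<noteq> 0" "L = proj_class vscale x" by (auto simp: proj_def)
    have "L \<in> PP n" using x assms(2) by (auto simp: PP_def proj_def)
    moreover have "y \<in> W" if "y \<in> L" for y
      using that x vs.subspace_scale[OF assms(1)] by (auto simp: proj_class_def)
    ultimately show "L \<in> zero_variety n s f"
      using van by (auto simp: zero_variety_def vanishes_on_def)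
  qed
qed

lemma tuples_through_eq:
  assumes "vs.subspace W" "W \<subseteq> Aff n" "\<forall>i<s. d i \<ge> 2"
  shows "tuples_through n s d (proj vscale W) = {f \<in> HomTuples n s d. vanishes_on s f W}"
  using plane_in_zero_variety_iff[OF assms(1,2) _ assms(3)] by (auto simp: tuples_through_def)

lemma vanishing_tuples_contain_lines:
  "contains_lines {f \<in> HomTuples n s d. vanishes_on s f W}"
  unfolding contains_lines_def
proof (intro ballI allI)
  fix f g t
  assume fg: "f \<in> {f \<in> HomTuples n s d. vanishes_on s f W}" "g \<in> {f \<in> HomTuples n s d. vanishes_on s f W}"
  define h where "h = (\<lambda>i. Poly_Mapping.single 0 (1 - t) * f i + Poly_Mapping.single 0 t * g i)"
  have "h \<in> HomTuples n s d" unfolding h_def using fg by (intro HomTuples_linear_combination) auto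
  moreover have "vanishes_on s h W"
    using fg by (auto simp: vanishes_on_def h_def mpol_eval_add mpol_eval_mult)
  moreover have "coeffs_of h = (\<lambda>a. coeffs_of f a + t * (coeffs_of g a - coeffs_of f a))"
    by (auto simp: fun_eq_iff coeffs_of_def h_def lookup_add lookup_scalar_mult
        left_diff_distrib right_diff_distrib)
  ultimately show "\<exists>h\<in>{f \<in> HomTuples n s d. vanishes_on s f W}.
      coeffs_of h = (\<lambda>a. coeffs_of f a + t * (coeffs_of g a - coeffs_of f a))" by blast
qed

lemma subspace_eq_if_same_dim:
  assumes W: "vs.subspace W" "vs.subspace W'" "W' \<subseteq> W" "vs.dim W = k + 1" "vs.dim W' = k + 1"
  shows "W' = W"
proof (rule ccontr)
  assume "W' \<noteq> W"
  then obtain x where x: "x \<in> W" "x \<notin> W'" using W(3) by blast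
  obtain b where b: "b \<subseteq> W" "vs.independent b" "W \<subseteq> vs.span b" "card b = k + 1"
    using vs.basis_exists[of W] W(4) by metis
  obtain b' where b': "b' \<subseteq> W'" "vs.independent b'" "W' \<subseteq> vs.span b'" "card b' = k + 1"
    using vs.basis_exists[of W'] W(5) by metis
  have fin: "finite b" "finite b'" using b(4) b'(4) card.infinite by fastforce+
  have "x \<notin> vs.span b'" using vs.span_minimal[OF b'(1) W(2)] x(2) by blast
  then have "vs.independent (insert x b')" "x \<notin> b'"
    using b'(2) vs.independent_insertI vs.span_base by auto
  moreover have "insert x b' \<subseteq> vs.span b" using x(1) W(3) b(3) b'(1) by blast
  ultimately have "card (insert x b') \<le> card b" using vs.independent_span_bound[OF fin(1)] by blast
  then show False using \<open>x \<notin> b'\<close> fin b(4) b'(4) by simp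
qed

lemma lin_Aff_eq:
  assumes "y \<in> Aff k" "k \<le> n"
  shows "lin n u y = lin k u y"
  unfolding lin_def fun_eq_iff
proof
  fix v
  show "(\<Sum>j\<le>n. y j * u j v) = (\<Sum>j\<le>k. y j * u j v)"
    by (rule sum.mono_neutral_right) (use assms in \<open>auto simp: Aff_def\<close>)
qed

text \<open>Only \<open>W'\<close> itself has all its pivots in \<open>{..k}\<close>: then all chart vectors are the unit vectors that
  span \<open>Aff k\<close>, so \<open>W\<close> contains \<open>W'\<close> and has the same dimension.\<close>

lemma other_plane_in_chart:
  assumes inv: "mutually_inverse n u \<beta>" and kn: "k \<le> n"
    and W': "W' = lin n u ` Aff k" "vs.subspace W'" "vs.dim W' = k + 1"
    and W: "vs.subspace W" "W \<subseteq> Aff n" "vs.dim W = k + 1" "W \<noteq> W'"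
  shows "\<exists>C N. C \<subseteq> {..n} \<and> card C = k + 1 \<and> \<not> C \<subseteq> {..k} \<and>
    (\<forall>j\<in>C. lin n u (chart_vector n k C N j) \<in> W)"
proof -
  obtain u2 \<beta>2 where inv2: "mutually_inverse n u2 \<beta>2" and W2: "W = lin n u2 ` Aff k"
    using adapted_basis[OF W(1-3) kn] by blast
  define \<gamma> where "\<gamma> j = lin n \<beta> (u2 j)" for j
  have zero: "lin m w 0 = 0" for m w by (simp add: lin_def fun_eq_iff)
  have kA: "y \<in> Aff n" if "y \<in> Aff k" for y using that kn by (auto simp: Aff_def)
  have A: "lin n u2 y \<in> Aff n" for y using inv2 by (intro lin_Aff) (simp add: mutually_inverse_def)
  have lin\<gamma>: "lin n u (lin k \<gamma> y) = lin n u2 y" if "y \<in> Aff k" for y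
  proof -
    have "lin k \<gamma> y = lin n \<beta> (lin n u2 y)"
      unfolding lin_Aff_eq[OF that kn] lin_lin by (simp add: \<gamma>_def[abs_def])
    then show ?thesis using inv A by (simp add: mutually_inverse_def)
  qed
  have "\<exists>C N. C \<subseteq> {..n} \<and> card C = k + 1 \<and> (\<forall>i\<in>C. chart_vector n k C N i \<in> lin k \<gamma> ` Aff k)"
  proof (rule subspace_has_chart[OF _ _ kn])
    show "\<gamma> j \<in> Aff n" for j
      unfolding \<gamma>_def using inv by (intro lin_Aff) (simp add: mutually_inverse_def)
    show "y = 0" if "y \<in> Aff k" "lin k \<gamma> y = 0" for y
    proof -
      have "lin n u2 y = 0" using lin\<gamma>[OF that(1)] that(2) by (simp add: zero)
      moreover have "lin n \<beta>2 (lin n u2 y) = y"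
        using inv2 kA[OF that(1)] by (simp add: mutually_inverse_def)
      ultimately show ?thesis by (simp add: zero)
    qed
  qed
  then obtain C N where C: "C \<subseteq> {..n}" "card C = k + 1"
    "\<forall>i\<in>C. chart_vector n k C N i \<in> lin k \<gamma> ` Aff k" by blast
  have CW: "lin n u (chart_vector n k C N j) \<in> W" if "j \<in> C" for j
  proof -
    obtain y where "y \<in> Aff k" "chart_vector n k C N j = lin k \<gamma> y" using C(3) \<open>j \<in> C\<close> by blast
    then show ?thesis using lin\<gamma> W2 by auto
  qed
  have "\<not> C \<subseteq> {..k}"
  proof
    assume "C \<subseteq> {..k}"
    then have Ck: "C = {..k}" using C(2) by (intro card_subset_eq) auto
    have "u j \<in> W" if "j \<le> k" for j
    proof -
      have "chart_vector n k C N j = unit j"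
        using that by (auto simp: chart_vector_def unit_def Ck fun_eq_iff)
      then have "lin n u (chart_vector n k C N j) = u j" using that kn by (simp add: lin_of_unit)
      then show ?thesis using CW[of j] that Ck by simp
    qed
    then have "W' \<subseteq> W"
      unfolding W'(1) using lin_Aff_eq[OF _ kn] lin_in_subspace[OF W(1)] by auto
    then show False using subspace_eq_if_same_dim[OF W(1) W'(2) _ W(3) W'(3)] W(4) by blast
  qed
  then show ?thesis using C CW by blast
qed

theorem theorem2p3:
  fixes n k s :: nat and d :: "nat \<Rightarrow> nat"
  assumes "k \<le> n" and "s \<ge> 1"
    and "\<forall>i<s. d i \<ge> 2"
    and "\<not> (s = 1 \<and> d 0 = 2)"
    and "delta n s d k < 0"
  shows "\<exists>U. dense_open (Gr_topology k n) U \<and>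
    (\<forall>\<Lambda>'\<in>U. \<exists>W. dense_open (PS_topology n s d \<Lambda>') W \<and>
      (\<forall>f. proj_class tscale f \<in> W \<longrightarrow> Fano k n (zero_variety n s f) = {\<Lambda>'}))"
proof (intro exI[of _ "Gr k n"] conjI ballI)
  have "topspace (Gr_topology k n) = Gr k n" by (simp add: Gr_topology_def topspace_zariski)
  then show "dense_open (Gr_topology k n) (Gr k n)"
    using openin_topspace[of "Gr_topology k n"] closure_of_topspace[of "Gr_topology k n"]
    by (simp add: dense_open_def)
next
  fix \<Lambda>' assume \<Lambda>': "\<Lambda>' \<in> Gr k n"
  obtain W' where W': "\<Lambda>' = proj vscale W'" "vs.subspace W'" "W' \<subseteq> Aff n" "vs.dim W' = k + 1"
    using \<Lambda>' by (auto simp: Gr_def)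
  obtain u \<beta> where inv: "mutually_inverse n u \<beta>" and W'u: "W' = lin n u ` Aff k"
    using adapted_basis[OF W'(2-4) assms(1)] by blast
  define S where "S = {f \<in> HomTuples n s d. vanishes_on s f W'}"
  have S: "tuples_through n s d \<Lambda>' = S"
    unfolding S_def W'(1) by (rule tuples_through_eq[OF W'(2,3) assms(3)])
  have lines: "contains_lines S" unfolding S_def by (rule vanishing_tuples_contain_lines)
  have "0 \<in> S" by (simp add: S_def HomTuples_def Hom_def homogeneous_def vanishes_on_def)
  have neg: "(k + 1) * (n - k) < (\<Sum>i<s. (k + 1 + d i - 1) choose d i)"
  proof -
    have "(k + 1 + d i - 1) choose d i = (d i + k) choose k" for i
      using binomial_symmetric[of k "d i + k"] by (simp add: add.commute)
    then have "(\<Sum>i<s. (k + 1 + d i - 1) choose d i) = (\<Sum>i<s. (d i + k) choose k)" by simp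
    moreover have "int ((k + 1) * (n - k)) < int (\<Sum>i<s. (d i + k) choose k)"
    proof -
      have "int ((k + 1) * (n - k)) = (int k + 1) * (int n - int k)"
        by (simp only: of_nat_mult of_nat_add of_nat_1 of_nat_diff[OF assms(1)])
      then show ?thesis using assms(5) by (simp add: delta_def)
    qed
    ultimately show ?thesis unfolding of_nat_less_iff by simp
  qed
  define charts where "charts = {C. C \<subseteq> {..n} \<and> card C = k + 1 \<and> \<not> C \<subseteq> {..k}}"
  have fin: "finite charts" by (rule finite_subset[of _ "Pow {..n}"]) (auto simp: charts_def)
  have "\<forall>C\<in>charts. \<exists>p. (\<exists>e. homogeneous e p) \<and>
    (\<exists>f\<in>HomTuples n s d. vanishes_on s f W' \<and> mpol_eval p (coeffs_of f) \<noteq> 0) \<and>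
    (\<forall>f\<in>HomTuples n s d. \<forall>N W. vanishes_on s f W' \<longrightarrow> vs.subspace W \<longrightarrow>
      (\<forall>j\<in>C. lin n u (chart_vector n k C N j) \<in> W) \<longrightarrow> vanishes_on s f W \<longrightarrow>
      mpol_eval p (coeffs_of f) = 0)"
    unfolding W'u charts_def
    by (intro ballI chart_obstruction[OF inv assms(1) _ _ _ assms(2,3,4) neg]) auto
  from bchoice[OF this] obtain p where p: "\<forall>C\<in>charts. (\<exists>e. homogeneous e (p C)) \<and>
    (\<exists>f\<in>HomTuples n s d. vanishes_on s f W' \<and> mpol_eval (p C) (coeffs_of f) \<noteq> 0) \<and>
    (\<forall>f\<in>HomTuples n s d. \<forall>N W. vanishes_on s f W' \<longrightarrow> vs.subspace W \<longrightarrow>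
      (\<forall>j\<in>C. lin n u (chart_vector n k C N j) \<in> W) \<longrightarrow> vanishes_on s f W \<longrightarrow>
      mpol_eval (p C) (coeffs_of f) = 0)" by (rule exE)
  have "\<forall>C\<in>charts. \<exists>e. homogeneous e (p C)" using p by blast
  from bchoice[OF this] obtain e where "\<forall>C\<in>charts. homogeneous (e C) (p C)" by (rule exE)
  then have hom: "homogeneous (\<Sum>C\<in>charts. e C) (\<Prod>C\<in>charts. p C)" by (intro homogeneous_prod) blast
  have "\<exists>f\<in>S. mpol_eval (\<Prod>C\<in>charts. p C) (coeffs_of f) \<noteq> 0"
  proof (rule nonzero_of_product[OF lines _ fin])
    show "S \<noteq> {}" using \<open>0 \<in> S\<close> by blast
    show "\<exists>f\<in>S. mpol_eval (p C) (coeffs_of f) \<noteq> 0" if "C \<in> charts" for C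
      using p that unfolding S_def by blast
  qed
  then obtain f0 where f0: "f0 \<in> S" "mpol_eval (\<Prod>C\<in>charts. p C) (coeffs_of f0) \<noteq> 0" by blast
  let ?W = "nonzero_locus (proj tscale S) ((`) coeffs_of) (\<Prod>C\<in>charts. p C)"
  show "\<exists>W. dense_open (PS_topology n s d \<Lambda>') W \<and>
      (\<forall>f. proj_class tscale f \<in> W \<longrightarrow> Fano k n (zero_variety n s f) = {\<Lambda>'})"
  proof (intro exI[of _ ?W] conjI allI impI)
    show "dense_open (PS_topology n s d \<Lambda>') ?W"
      unfolding PS_topology_def S by (rule dense_open_nonzero_locus[OF lines hom f0])
    fix f assume f: "proj_class tscale f \<in> ?W"
    have self: "f \<in> proj_class tscale f"
      using tscale_one[of f] unfolding proj_class_def by (auto intro!: exI[of _ 1])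
    then have nz: "mpol_eval (\<Prod>C\<in>charts. p C) (coeffs_of f) \<noteq> 0"
      using f by (simp add: nonzero_locus_def)
    obtain g where g: "g \<in> S" "proj_class tscale f = proj_class tscale g"
      using f by (auto simp: nonzero_locus_def proj_def)
    then obtain c where c: "f = tscale c g" using self by (auto simp: proj_class_def)
    have fH: "f \<in> HomTuples n s d"
      using g(1) HomTuples_linear_combination[of g n s d g c 0] by (simp add: S_def c tscale_eq)
    have fW': "vanishes_on s f W'"
      using g(1) by (simp add: S_def c tscale_eq vanishes_on_def mpol_eval_mult)
    note iff = plane_in_zero_variety_iff[OF _ _ fH assms(3)]
    have "\<Lambda> = \<Lambda>'" if \<Lambda>: "\<Lambda> \<in> Fano k n (zero_variety n s f)" for \<Lambda>
    proof (rule ccontr)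
      assume ne: "\<Lambda> \<noteq> \<Lambda>'"
      obtain W where W: "\<Lambda> = proj vscale W" "vs.subspace W" "W \<subseteq> Aff n" "vs.dim W = k + 1"
        using \<Lambda> by (auto simp: Fano_def Gr_def)
      have fW: "vanishes_on s f W" using \<Lambda> iff[OF W(2,3)] by (simp add: Fano_def W(1))
      have "W \<noteq> W'" using ne W(1) W'(1) by blast
      from other_plane_in_chart[OF inv assms(1) W'u W'(2,4) W(2-4) this]
      obtain C N where C: "C \<in> charts" "\<forall>j\<in>C. lin n u (chart_vector n k C N j) \<in> W"
        unfolding charts_def by blast
      then have "mpol_eval (p C) (coeffs_of f) = 0" using p fH fW' W(2) fW by blast
      then have "mpol_eval (\<Prod>C\<in>charts. p C) (coeffs_of f) = 0"
        using fin C(1) unfolding mpol_eval_prod by (intro prod_zero) auto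
      then show False using nz by simp
    qed
    moreover have "\<Lambda>' \<in> Fano k n (zero_variety n s f)"
      using \<Lambda>' iff[OF W'(2,3)] fW' by (simp add: Fano_def W'(1))
    ultimately show "Fano k n (zero_variety n s f) = {\<Lambda>'}" by blast
  qed
qed

end
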